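(* Let $\mathcal G$ be a compact, connected, finite metric graph which is a tree, with non-empty Dirichlet vertex set $\mathsf V_{\mathrm D}$. If $\mathcal G$ has precisely one Dirichlet vertex, then \[ T(\mathcal G)\ge\tfrac13\operatorname{Inr}(\mathcal G;\mathsf V_{\mathrm D})^3 . \] If $\mathcal G$ has precisely two Dirichlet vertices $\mathsf v,\mathsf w$, then \[ T(\mathcal G)\ge\tfrac1{12}\operatorname{dist}(\mathsf v,\mathsf w)^3 . \]
   Context: A compact, connected, finite metric graph consists of finitely many edges $\mathsf e\simeq[0,\ell_{\mathsf e}]$, $0<\ell_{\mathsf e}<\infty$, glued at their endpoints (vertices) to form a connected space; it is a tree if it is simply connected (contains no cycles). $\operatorname{dist}$ is the path metric and $\operatorname{Inr}(\mathcal G;\mathsf V_{\mathrm D})=\sup_{x\in\mathcal G}\min_{\mathsf v\in\mathsf V_{\mathrm D}}\operatorname{dist}(x,\mathsf v)$. The torsion function $v$ with respect to the Dirichlet vertex set $\mathsf V_{\mathrm D}$ is the unique function that is continuous on $\mathcal G$, in $H^2$ on each edge, with $-v_{\mathsf e}''=1$ on each edge, $v=0$ on $\mathsf V_{\mathrm D}$, and sum of normal derivatives over all incident edges equal to $0$ at each other vertex. The torsional rigidity is $T(\mathcal G)=T(\mathcal G;\mathsf V_{\mathrm D})=\int_{\mathcal G}v\,dx$. *)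

theory Defs
  imports "HOL-Analysis.Analysis"
begin

section \<open>Metric graphs\<close>

text \<open>
  The underlying graph is an undirected multigraph: parallel edges and loops are allowed.
  An edge \<open>e\<close> is a copy of the interval \<open>{0..len G e}\<close>, with \<open>0\<close> glued to the vertex
  \<open>tail G e\<close> and \<open>len G e\<close> glued to the vertex \<open>head G e\<close>. The choice of tail and head only
  fixes the direction of parametrisation.
\<close>

record ('v, 'e) metric_graph =
  verts :: "'v set"
  edges :: "'e set"
  tail :: "'e \<Rightarrow> 'v"
  head :: "'e \<Rightarrow> 'v"
  len :: "'e \<Rightarrow> real"

definition adjacency :: "('v, 'e) metric_graph \<Rightarrow> ('v \<times> 'v) set" where
  "adjacency G = (\<Union>e\<in>edges G. {(tail G e, head G e), (head G e, tail G e)})"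

locale compact_connected_metric_graph =
  fixes G :: "('v, 'e) metric_graph"
  assumes finite_verts: "finite (verts G)"
    and finite_edges: "finite (edges G)"
    and tail_in_verts: "e \<in> edges G \<Longrightarrow> tail G e \<in> verts G"
    and head_in_verts: "e \<in> edges G \<Longrightarrow> head G e \<in> verts G"
    and len_pos: "e \<in> edges G \<Longrightarrow> 0 < len G e"
    and verts_nonempty: "verts G \<noteq> {}"
    and connected_verts: "x \<in> verts G \<Longrightarrow> y \<in> verts G \<Longrightarrow> (x, y) \<in> (adjacency G)\<^sup>*"

text \<open>An edge traversed from tail to head is \<open>(e, True)\<close>, from head to tail \<open>(e, False)\<close>.\<close>

fun start_vertex :: "('v, 'e) metric_graph \<Rightarrow> 'e \<times> bool \<Rightarrow> 'v" where
  "start_vertex G (e, b) = (if b then tail G e else head G e)"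

fun end_vertex :: "('v, 'e) metric_graph \<Rightarrow> 'e \<times> bool \<Rightarrow> 'v" where
  "end_vertex G (e, b) = (if b then head G e else tail G e)"

text \<open>A loop is a cycle of length one, two parallel edges form a cycle of length two.\<close>

definition is_cycle :: "('v, 'e) metric_graph \<Rightarrow> ('e \<times> bool) list \<Rightarrow> bool" where
  "is_cycle G ds \<longleftrightarrow>
     ds \<noteq> [] \<and> fst ` set ds \<subseteq> edges G \<and>
     (\<forall>i < length ds. end_vertex G (ds ! i) = start_vertex G (ds ! (Suc i mod length ds))) \<and>
     distinct (map fst ds) \<and> distinct (map (start_vertex G) ds)"

definition acyclic_graph :: "('v, 'e) metric_graph \<Rightarrow> bool" where
  "acyclic_graph G \<longleftrightarrow> (\<nexists>ds. is_cycle G ds)"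

subsection \<open>Points and the path metric\<close>

datatype ('v, 'e) point = Vertex 'v | Interior 'e real

definition edge_point :: "('v, 'e) metric_graph \<Rightarrow> 'e \<Rightarrow> real \<Rightarrow> ('v, 'e) point" where
  "edge_point G e t =
     (if t = 0 then Vertex (tail G e)
      else if t = len G e then Vertex (head G e)
      else Interior e t)"

definition points :: "('v, 'e) metric_graph \<Rightarrow> ('v, 'e) point set" where
  "points G = Vertex ` verts G \<union> (\<Union>e\<in>edges G. edge_point G e ` {0..len G e})"

text \<open>
  \<open>joined G p q L\<close>: there is a path of length \<open>L\<close> from \<open>p\<close> to \<open>q\<close> that consists of finitely many
  segments, each contained in a single edge.
\<close>

inductive joined ::
    "('v, 'e) metric_graph \<Rightarrow> ('v, 'e) point \<Rightarrow> ('v, 'e) point \<Rightarrow> real \<Rightarrow> bool"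
  for G where
  refl: "p \<in> points G \<Longrightarrow> joined G p p 0"
| step: "joined G p (edge_point G e s) L \<Longrightarrow> e \<in> edges G \<Longrightarrow>
         s \<in> {0..len G e} \<Longrightarrow> t \<in> {0..len G e} \<Longrightarrow>
         joined G p (edge_point G e t) (L + \<bar>t - s\<bar>)"

definition path_dist ::
    "('v, 'e) metric_graph \<Rightarrow> ('v, 'e) point \<Rightarrow> ('v, 'e) point \<Rightarrow> real" where
  "path_dist G p q = Inf {L. joined G p q L}"

definition inradius :: "('v, 'e) metric_graph \<Rightarrow> 'v set \<Rightarrow> real" where
  "inradius G D = (SUP x\<in>points G. Min ((\<lambda>v. path_dist G x (Vertex v)) ` D))"

section \<open>Sobolev spaces on an interval\<close>

text \<open>
  \<open>H1 l u g\<close> says that \<open>u\<close> belongs to \<open>H\<^sup>1(0, l)\<close> and has weak derivative \<open>g\<close>; the test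
  functions are the \<open>C\<^sup>1\<close> functions with compact support in \<open>(0, l)\<close>, given together with
  their derivative. A function \<open>u\<close> is in \<open>H\<^sup>2(0, l)\<close> if \<open>u\<close> and its weak derivative are
  both in \<open>H\<^sup>1(0, l)\<close>.
\<close>

definition test_function :: "real \<Rightarrow> (real \<Rightarrow> real) \<Rightarrow> (real \<Rightarrow> real) \<Rightarrow> bool" where
  "test_function l \<phi> \<phi>' \<longleftrightarrow>
     (\<forall>t. (\<phi> has_real_derivative \<phi>' t) (at t)) \<and> continuous_on UNIV \<phi>' \<and>
     (\<exists>a b. 0 < a \<and> a < b \<and> b < l \<and> (\<forall>t. t \<notin> {a..b} \<longrightarrow> \<phi> t = 0))"

definition L2 :: "real \<Rightarrow> (real \<Rightarrow> real) set" where
  "L2 l = {u \<in> borel_measurable (lebesgue_on {0<..<l}).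
             integrable (lebesgue_on {0<..<l}) (\<lambda>t. (u t)\<^sup>2)}"

definition H1 :: "real \<Rightarrow> (real \<Rightarrow> real) \<Rightarrow> (real \<Rightarrow> real) \<Rightarrow> bool" where
  "H1 l u g \<longleftrightarrow> u \<in> L2 l \<and> g \<in> L2 l \<and>
     (\<forall>\<phi> \<phi>'. test_function l \<phi> \<phi>' \<longrightarrow>
        (LINT t|lebesgue_on {0<..<l}. u t * \<phi>' t) =
        - (LINT t|lebesgue_on {0<..<l}. g t * \<phi> t))"

section \<open>Torsion function and torsional rigidity\<close>

definition continuous_on_graph ::
    "('v, 'e) metric_graph \<Rightarrow> (('v, 'e) point \<Rightarrow> real) \<Rightarrow> bool" where
  "continuous_on_graph G u \<longleftrightarrow>
     (\<forall>p\<in>points G. \<forall>\<epsilon>>0. \<exists>\<delta>>0. \<forall>q\<in>points G. path_dist G p q < \<delta> \<longrightarrow> \<bar>u q - u p\<bar> < \<epsilon>)"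

definition on_edge ::
    "('v, 'e) metric_graph \<Rightarrow> (('v, 'e) point \<Rightarrow> real) \<Rightarrow> 'e \<Rightarrow> real \<Rightarrow> real" where
  "on_edge G u e t = u (edge_point G e t)"

text \<open>
  Sum of the derivatives at \<open>x\<close> in the direction pointing into the edge, over all edge ends
  at \<open>x\<close>; a loop at \<open>x\<close> contributes to both sums. The one-sided derivatives exist for functions
  that are in \<open>H\<^sup>2\<close> and continuous on the closed edges, since these are continuously
  differentiable up to the end points.
\<close>

definition normal_derivative_sum ::
    "('v, 'e) metric_graph \<Rightarrow> (('v, 'e) point \<Rightarrow> real) \<Rightarrow> 'v \<Rightarrow> real" where
  "normal_derivative_sum G u x =
     (\<Sum>e | e \<in> edges G \<and> tail G e = x.
        vector_derivative (on_edge G u e) (at 0 within {0..len G e})) +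
     (\<Sum>e | e \<in> edges G \<and> head G e = x.
        - vector_derivative (on_edge G u e) (at (len G e) within {0..len G e}))"

text \<open>
  Functions on the graph are represented as elements of \<open>extensional (points G)\<close>, so that
  the torsion function is unique as a HOL function.
\<close>

definition is_torsion_function ::
    "('v, 'e) metric_graph \<Rightarrow> 'v set \<Rightarrow> (('v, 'e) point \<Rightarrow> real) \<Rightarrow> bool" where
  "is_torsion_function G D u \<longleftrightarrow>
     u \<in> extensional (points G) \<and>
     continuous_on_graph G u \<and>
     (\<forall>e\<in>edges G. \<exists>u' u''. H1 (len G e) (on_edge G u e) u' \<and> H1 (len G e) u' u'' \<and>
        (AE t in lebesgue_on {0<..<len G e}. - u'' t = 1)) \<and>
     (\<forall>x\<in>D. u (Vertex x) = 0) \<and>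
     (\<forall>x\<in>verts G - D. normal_derivative_sum G u x = 0)"

definition torsion_function ::
    "('v, 'e) metric_graph \<Rightarrow> 'v set \<Rightarrow> ('v, 'e) point \<Rightarrow> real" where
  "torsion_function G D = (THE u. is_torsion_function G D u)"

definition graph_integral ::
    "('v, 'e) metric_graph \<Rightarrow> (('v, 'e) point \<Rightarrow> real) \<Rightarrow> real" where
  "graph_integral G u = (\<Sum>e\<in>edges G. LINT t|lebesgue_on {0..len G e}. on_edge G u e t)"

definition torsional_rigidity :: "('v, 'e) metric_graph \<Rightarrow> 'v set \<Rightarrow> real" where
  "torsional_rigidity G D = graph_integral G (torsion_function G D)"

end

theory Submission
  imports Defs
begin

text \<open>
  On every edge the torsion function is the quadratic \<open>a + (b - a) t / l + t (l - t) / 2\<close>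
  determined by its end values, so it solves a discrete Dirichlet problem on the vertices, which
  has exactly one solution because its energy form is definite. By the Dirichlet principle
  \<open>T \<ge> 2 \<integral> \<phi> - \<integral> \<phi>'\<^sup>2\<close> for all \<open>\<phi>\<close> that vanish on the Dirichlet vertices.

  In a tree, a trail of length \<open>L\<close> carries a projection of the whole graph onto \<open>[0, L]\<close>, which
  moves with unit speed along the trail and is constant on all other edges. Composing it with the
  torsion function \<open>L p - p\<^sup>2 / 2\<close> of an interval with one Dirichlet end, or with
  \<open>(L p - p\<^sup>2) / 2\<close> in the case of two Dirichlet ends, gives test functions that yield \<open>L\<^sup>3 / 3\<close> and
  \<open>L\<^sup>3 / 12\<close>, since \<open>\<phi> \<ge> 0\<close> and \<open>\<phi>' = 0\<close> off the trail. Every point of the graph lies on a trail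
  that starts at the given Dirichlet vertex, which bounds the inradius.
\<close>

section \<open>Weak solutions of \<open>- u'' = 1\<close> on an interval\<close>

lemma has_real_derivative_imp_continuous_on:
  assumes "\<And>t. (f has_real_derivative f' t) (at t)"
  shows "continuous_on S f"
  using assms by (meson DERIV_isCont continuous_at_imp_continuous_on)

lemma continuous_imp_integrable_Ioo:
  fixes f :: "real \<Rightarrow> real"
  assumes "continuous_on {a..b} f"
  shows "integrable (lebesgue_on {a<..<b}) f"
proof -
  have "f absolutely_integrable_on {a<..<b}"
    using absolutely_integrable_continuous_real[OF assms] by (rule set_integrable_subset) auto
  then show ?thesis
    by (simp add: absolutely_integrable_imp_integrable)
qed

lemma integral_lebesgue_on_Ioo:
  fixes f :: "real \<Rightarrow> real"
  assumes "continuous_on {a..b} f"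
  shows "(LINT t|lebesgue_on {a<..<b}. f t) = integral {a..b} f"
  using lebesgue_integral_eq_integral[OF continuous_imp_integrable_Ioo[OF assms]]
  by (simp add: integral_open_interval_real)

lemma continuous_imp_L2:
  assumes "continuous_on {0..l} f"
  shows "f \<in> L2 l"
proof -
  have "continuous_on {0..l} (\<lambda>t. (f t)\<^sup>2)"
    using assms by (intro continuous_intros)
  then show ?thesis
    unfolding L2_def using continuous_imp_integrable_Ioo[OF assms] continuous_imp_integrable_Ioo
    by blast
qed

lemma integral_by_parts_vanishing:
  fixes f :: "real \<Rightarrow> real"
  assumes f: "\<And>t. (f has_real_derivative f' t) (at t)" and f': "continuous_on UNIV f'"
    and g: "\<And>t. (g has_real_derivative g' t) (at t)" and g': "continuous_on UNIV g'"
    and "0 \<le> l" "g 0 = 0" "g l = 0"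
  shows "integral {0..l} (\<lambda>t. f t * g' t) = - integral {0..l} (\<lambda>t. f' t * g t)"
proof -
  have cf: "continuous_on {0..l} f" and cg: "continuous_on {0..l} g"
    by (rule has_real_derivative_imp_continuous_on[OF f] has_real_derivative_imp_continuous_on[OF g])+
  have cf': "continuous_on {0..l} f'" and cg': "continuous_on {0..l} g'"
    by (rule continuous_on_subset[OF f'] continuous_on_subset[OF g'], simp)+
  have i: "(\<lambda>t. f t * g' t) integrable_on {0..l}" "(\<lambda>t. f' t * g t) integrable_on {0..l}"
    by (rule integrable_continuous_real[OF continuous_on_mult[OF cf cg']],
        rule integrable_continuous_real[OF continuous_on_mult[OF cf' cg]])
  have "((\<lambda>t. f t * g t) has_real_derivative f x * g' x + f' x * g x) (at x)" for x
    using DERIV_mult[OF f[of x] g[of x]] by (simp add: mult.commute add.commute)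
  then have "((\<lambda>t. f t * g t) has_vector_derivative f x * g' x + f' x * g x) (at x within {0..l})" for x
    unfolding has_real_derivative_iff_has_vector_derivative by (rule has_vector_derivative_at_within)
  then have "((\<lambda>t. f t * g' t + f' t * g t) has_integral f l * g l - f 0 * g 0) {0..l}"
    by (rule fundamental_theorem_of_calculus[OF \<open>0 \<le> l\<close>, where f="\<lambda>t. f t * g t"])
  then have "integral {0..l} (\<lambda>t. f t * g' t + f' t * g t) = 0"
    using \<open>g 0 = 0\<close> \<open>g l = 0\<close> by (simp add: integral_unique)
  then show ?thesis
    using integral_add[OF i] by simp
qed

lemma test_function_continuous:
  assumes "test_function l \<phi> \<phi>'"
  shows "continuous_on S \<phi>" "continuous_on S \<phi>'"
proof -
  have d: "\<And>t. (\<phi> has_real_derivative \<phi>' t) (at t)" and c: "continuous_on UNIV \<phi>'"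
    using assms unfolding test_function_def by blast+
  show "continuous_on S \<phi>" "continuous_on S \<phi>'"
    by (rule has_real_derivative_imp_continuous_on[OF d], rule continuous_on_subset[OF c], simp)
qed

lemma test_functionI:
  assumes "\<And>t. (\<phi> has_real_derivative \<phi>' t) (at t)" "continuous_on UNIV \<phi>'"
    and "\<And>t. t \<notin> {a<..<b} \<Longrightarrow> \<phi> t = 0" "0 < a" "a < b" "b < l"
  shows "test_function l \<phi> \<phi>'"
proof -
  have "\<forall>t. t \<notin> {a..b} \<longrightarrow> \<phi> t = 0"
    using assms(3) by auto
  then show ?thesis
    unfolding test_function_def using assms by blast
qed

lemma C1_imp_H1:
  fixes f :: "real \<Rightarrow> real"
  assumes f: "\<And>t. (f has_real_derivative f' t) (at t)" and f': "continuous_on UNIV f'"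
    and "0 < l"
  shows "H1 l f f'"
proof -
  have cf: "continuous_on {0..l} f" and cf': "continuous_on {0..l} f'"
    by (rule has_real_derivative_imp_continuous_on[OF f], rule continuous_on_subset[OF f'], simp)
  have "(LINT t|lebesgue_on {0<..<l}. f t * \<phi>' t) = - (LINT t|lebesgue_on {0<..<l}. f' t * \<phi> t)"
    if t: "test_function l \<phi> \<phi>'" for \<phi> \<phi>'
  proof -
    from t have "\<phi> 0 = 0" "\<phi> l = 0"
      unfolding test_function_def by force+
    moreover have "\<And>t. (\<phi> has_real_derivative \<phi>' t) (at t)" "continuous_on UNIV \<phi>'"
      using t unfolding test_function_def by auto
    ultimately have "integral {0..l} (\<lambda>t. f t * \<phi>' t) = - integral {0..l} (\<lambda>t. f' t * \<phi> t)"
      using f f' \<open>0 < l\<close> by (intro integral_by_parts_vanishing) auto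
    moreover have "continuous_on {0..l} (\<lambda>t. f t * \<phi>' t)" "continuous_on {0..l} (\<lambda>t. f' t * \<phi> t)"
      using cf cf' test_function_continuous[OF t] by (auto intro!: continuous_intros)
    ultimately show ?thesis
      by (simp add: integral_lebesgue_on_Ioo)
  qed
  then show ?thesis
    unfolding H1_def using continuous_imp_L2 cf cf' by blast
qed

lemma H1_cong:
  assumes "\<And>t. t \<in> {0<..<l} \<Longrightarrow> u t = v t"
  shows "H1 l u g \<longleftrightarrow> H1 l v g"
proof -
  have "u \<in> L2 l \<longleftrightarrow> v \<in> L2 l"
    unfolding L2_def using assms measurable_cong[of "lebesgue_on {0<..<l}" u v borel]
      Bochner_Integration.integrable_cong[OF HOL.refl, of "lebesgue_on {0<..<l}" "\<lambda>t. (u t)\<^sup>2" "\<lambda>t. (v t)\<^sup>2"]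
    by simp
  moreover have "(LINT t|lebesgue_on {0<..<l}. u t * \<phi> t) = (LINT t|lebesgue_on {0<..<l}. v t * \<phi> t)" for \<phi>
    using assms by (intro Bochner_Integration.integral_cong) auto
  ultimately show ?thesis
    unfolding H1_def by simp
qed

text \<open>An antiderivative is constant on each side of \<open>{a<..<b}\<close>; the vanishing
  integral makes the two constants agree, and subtracting their common value keeps the support. Two
  applications turn a weight orthogonal to 1 and t into the second derivative of a test
  function.\<close>

lemma compactly_supported_primitive:
  fixes g :: "real \<Rightarrow> real"
  assumes g: "continuous_on UNIV g" and supp: "\<And>t. t \<notin> {a<..<b} \<Longrightarrow> g t = 0"
    and ab: "0 < a" "a < b" "b < l" and int: "integral {0..l} g = 0"
  obtains F where "\<And>t. (F has_real_derivative g t) (at t)" "\<And>t. t \<notin> {a<..<b} \<Longrightarrow> F t = 0"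
proof -
  have "\<exists>F. \<forall>x::real. -\<infinity> < ereal x \<longrightarrow> ereal x < \<infinity> \<longrightarrow> (F has_vector_derivative g x) (at x)"
    using g by (intro einterval_antiderivative) (auto simp: continuous_on_eq_continuous_at)
  then obtain F where F: "\<And>x. (F has_real_derivative g x) (at x)"
    by (auto simp: has_real_derivative_iff_has_vector_derivative)
  have "\<exists>c. \<forall>x\<in>S. F x = c" if "convex S" "S \<inter> {a<..<b} = {}" for S
    using that by (intro has_field_derivative_zero_constant)
      (use F supp in \<open>metis disjoint_iff has_field_derivative_at_within\<close>)+
  from this[of "{..a}"] this[of "{b..}"]
  obtain c d where c: "\<And>x. x \<le> a \<Longrightarrow> F x = c" and d: "\<And>x. b \<le> x \<Longrightarrow> F x = d"
    by (auto simp: disjoint_iff)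
  have "(g has_integral F l - F 0) {0..l}"
    using F ab
    by (intro fundamental_theorem_of_calculus[where f=F])
       (auto simp: has_real_derivative_iff_has_vector_derivative[symmetric]
         intro: has_field_derivative_at_within)
  then have "c = d"
    using int c[of 0] d[of l] ab by (simp add: integral_unique)
  show thesis
  proof
    show "((\<lambda>t. F t - c) has_real_derivative g t) (at t)" for t
      using F[of t] by (auto intro!: derivative_eq_intros)
    show "F t - c = 0" if "t \<notin> {a<..<b}" for t
      using that c d \<open>c = d\<close> by force
  qed
qed

text \<open>The orthogonality conditions give \<theta> = \<phi>'' for a test function \<phi>. Moving
  both derivatives onto the other factor yields - \<integral> \<phi> for u and + \<integral> \<phi>
  for t^2 / 2, so the sum cancels.\<close>

lemma weak_solution_annihilates:
  fixes u :: "real \<Rightarrow> real"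
  assumes l: "0 < l" and u: "continuous_on {0..l} u"
    and H: "H1 l u u'" "H1 l u' u''" and ae: "AE t in lebesgue_on {0<..<l}. - u'' t = 1"
    and \<theta>: "continuous_on UNIV \<theta>" "\<And>t. t \<notin> {a<..<b} \<Longrightarrow> \<theta> t = 0"
    and ab: "0 < a" "a < b" "b < l"
    and orth: "integral {0..l} \<theta> = 0" "integral {0..l} (\<lambda>t. t * \<theta> t) = 0"
  shows "integral {0..l} (\<lambda>t. (u t + t\<^sup>2 / 2) * \<theta> t) = 0"
proof -
  obtain \<phi>' where \<phi>': "\<And>t. (\<phi>' has_real_derivative \<theta> t) (at t)"
      and s': "\<And>t. t \<notin> {a<..<b} \<Longrightarrow> \<phi>' t = 0"
    using compactly_supported_primitive[OF \<theta> ab orth(1)] by blast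
  have c': "continuous_on UNIV \<phi>'"
    by (rule has_real_derivative_imp_continuous_on[OF \<phi>'])
  \<comment> \<open>The vanishing first moment is, after integration by parts, the condition for a
    second compactly supported primitive.\<close>
  have "integral {0..l} (\<lambda>t. t * \<theta> t) = - integral {0..l} (\<lambda>t. 1 * \<phi>' t)"
    using \<phi>' \<theta> s' ab by (intro integral_by_parts_vanishing) auto
  then have "integral {0..l} \<phi>' = 0"
    using orth by simp
  then obtain \<phi> where \<phi>: "\<And>t. (\<phi> has_real_derivative \<phi>' t) (at t)"
      and s: "\<And>t. t \<notin> {a<..<b} \<Longrightarrow> \<phi> t = 0"
    using compactly_supported_primitive[OF c' s' ab] by blast
  have c: "continuous_on UNIV \<phi>"
    by (rule has_real_derivative_imp_continuous_on[OF \<phi>])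
  have c0: "continuous_on {0..l} \<theta>" "continuous_on {0..l} \<phi>"
    using \<theta>(1) c continuous_on_subset subset_UNIV by blast+
  \<comment> \<open>The weak derivative is used twice: \<open>u\<close> is tested with \<phi>' and
    \<open>u'\<close> with \<phi>.\<close>
  have tf: "test_function l \<phi>' \<theta>" "test_function l \<phi> \<phi>'"
    by (rule test_functionI[OF \<phi>' \<theta>(1) s' ab], simp, rule test_functionI[OF \<phi> c' s ab], simp)
  have weak: "(LINT t|lebesgue_on {0<..<l}. v t * \<psi>' t) = - (LINT t|lebesgue_on {0<..<l}. v' t * \<psi> t)"
    if "H1 l v v'" "test_function l \<psi> \<psi>'" for v v' \<psi> \<psi>'
    using that unfolding H1_def by blast
  have m: "\<phi> \<in> borel_measurable (lebesgue_on {0<..<l})"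
    by (rule continuous_imp_measurable_on_sets_lebesgue[OF continuous_on_subset[OF c]]) auto
  have m': "u'' \<in> borel_measurable (lebesgue_on {0<..<l})"
    using H(2) unfolding H1_def L2_def by simp
  have "AE t in lebesgue_on {0<..<l}. u'' t * \<phi> t = - \<phi> t"
    using ae by eventually_elim (simp add: minus_equation_iff[of _ 1])
  then have "(LINT t|lebesgue_on {0<..<l}. u'' t * \<phi> t) = (LINT t|lebesgue_on {0<..<l}. - \<phi> t)"
    by (rule integral_cong_AE[OF borel_measurable_times[OF m' m] borel_measurable_uminus[OF m]])
  moreover have "(LINT t|lebesgue_on {0<..<l}. u t * \<theta> t) = (LINT t|lebesgue_on {0<..<l}. u'' t * \<phi> t)"
    using weak[OF H(1) tf(1)] weak[OF H(2) tf(2)] by linarith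
  ultimately have 1: "integral {0..l} (\<lambda>t. u t * \<theta> t) = - integral {0..l} \<phi>"
    unfolding integral_lebesgue_on_Ioo[OF continuous_on_mult[OF u c0(1)]]
      integral_lebesgue_on_Ioo[OF continuous_on_minus[OF c0(2)]] by simp
  have "integral {0..l} (\<lambda>t. t\<^sup>2 / 2 * \<theta> t) = - integral {0..l} (\<lambda>t. t * \<phi>' t)"
    using \<phi>' \<theta> s' ab by (intro integral_by_parts_vanishing) (auto intro!: derivative_eq_intros continuous_intros)
  also have "\<dots> = integral {0..l} (\<lambda>t. 1 * \<phi> t)"
    using integral_by_parts_vanishing[of "\<lambda>t. t" "\<lambda>t. 1" \<phi> \<phi>' l] \<phi> c' s ab by auto
  finally have 2: "integral {0..l} (\<lambda>t. t\<^sup>2 / 2 * \<theta> t) = integral {0..l} \<phi>"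
    by simp
  have "integral {0..l} (\<lambda>t. u t * \<theta> t + t\<^sup>2 / 2 * \<theta> t) =
      integral {0..l} (\<lambda>t. u t * \<theta> t) + integral {0..l} (\<lambda>t. t\<^sup>2 / 2 * \<theta> t)"
    by (intro integral_add integrable_continuous_real continuous_intros u c0(1)) simp
  then show ?thesis
    using 1 2 by (simp add: algebra_simps)
qed

text \<open>
  Let \<open>p\<close> be the orthogonal projection of \<open>z\<close> onto the affine functions with respect to a bump
  weight \<open>\<omega>\<close>; testing with \<open>(z - p) \<omega>\<close> shows that \<open>z = p\<close> where \<open>\<omega> > 0\<close>.
\<close>

lemma affine_if_annihilates:
  fixes z :: "real \<Rightarrow> real"
  assumes z: "continuous_on {0..l} z" and ab: "0 < a" "a < b" "b < l"
    and ann: "\<And>\<theta>. \<lbrakk>continuous_on UNIV \<theta>; \<And>t. t \<notin> {a<..<b} \<Longrightarrow> \<theta> t = 0;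
       integral {0..l} \<theta> = 0; integral {0..l} (\<lambda>t. t * \<theta> t) = 0\<rbrakk>
      \<Longrightarrow> integral {0..l} (\<lambda>t. z t * \<theta> t) = 0"
  shows "\<exists>\<alpha> \<beta>. \<forall>t\<in>{a<..<b}. z t = \<alpha> + \<beta> * t"
proof -
  define \<omega> :: "real \<Rightarrow> real" where "\<omega> t = max 0 ((t - a) * (b - t))" for t
  \<comment> \<open>Clamping the argument to [0, l] extends \<open>z\<close> continuously to the
    line, since a weight for \<open>ann\<close> has to be continuous on \<open>UNIV\<close>.\<close>
  define w :: "real \<Rightarrow> real" where "w t = z (max 0 (min l t))" for t
  have c\<omega>: "continuous_on S \<omega>" for S
    unfolding \<omega>_def by (intro continuous_intros)
  have cw: "continuous_on S w" for S
    unfolding w_def using ab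
    by (intro continuous_on_compose2[OF z]) (auto intro!: continuous_intros)
  have pos: "\<omega> t > 0" if "t \<in> {a<..<b}" for t
    using that by (auto simp: \<omega>_def less_max_iff_disj)
  have supp: "\<omega> t = 0" if "t \<notin> {a<..<b}" for t
  proof -
    have "(t - a) * (b - t) \<le> 0"
      using that ab by (cases "t \<le> a") (auto intro: mult_nonpos_nonneg mult_nonneg_nonpos)
    then show ?thesis
      by (simp add: \<omega>_def)
  qed
  have zeroD: "f t = 0" if "integral {0..l} (\<lambda>t. (f t)\<^sup>2 * \<omega> t) = 0" "continuous_on {0..l} f"
    "t \<in> {a<..<b}" for f t
  proof -
    have "\<forall>t\<in>{0..l}. (f t)\<^sup>2 * \<omega> t = 0"
      using that(1,2) ab c\<omega>
      by (subst integral_eq_0_iff[symmetric]) (auto intro!: continuous_intros simp: \<omega>_def)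
    then show ?thesis
      using pos[OF that(3)] that(3) ab by force
  qed
  have lin: "integral {0..l} (\<lambda>t. f t - (c * g t + d * h t))
      = integral {0..l} f - (c * integral {0..l} g + d * integral {0..l} h)"
    if "continuous_on {0..l} f" "continuous_on {0..l} g" "continuous_on {0..l} h"
    for c d and f g h :: "real \<Rightarrow> real"
  proof -
    have "(f has_integral integral {0..l} f) {0..l}" "(g has_integral integral {0..l} g) {0..l}"
      "(h has_integral integral {0..l} h) {0..l}"
      using that integrable_continuous_real by blast+
    then show ?thesis
      by (intro integral_unique has_integral_diff has_integral_add has_integral_mult_right)
  qed
  define m where "m = (a + b) / 2"
  have m: "m \<in> {a<..<b}" "(m + b) / 2 \<in> {a<..<b}"
    using ab by (auto simp: m_def field_simps)
  define I where "I = integral {0..l} \<omega>"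
  have I: "I \<noteq> 0"
    using zeroD[of "\<lambda>_. 1" m] m(1) by (auto simp: I_def)
  \<comment> \<open>\<tau> is the \<omega>-weighted mean of t, so 1 and t - \<tau> are orthogonal
    for the weight \<omega>. \<open>I\<close> and \<open>J\<close> are their squared norms,
    \<open>c\<close> and \<open>d\<close> the projection coefficients of \<open>w\<close>.\<close>
  define \<tau> where "\<tau> = integral {0..l} (\<lambda>t. t * \<omega> t) / I"
  define J where "J = integral {0..l} (\<lambda>t. (t - \<tau>)\<^sup>2 * \<omega> t)"
  have J: "J \<noteq> 0"
  proof
    assume "J = 0"
    then have "t = \<tau>" if "t \<in> {a<..<b}" for t
      using zeroD[of "\<lambda>t. t - \<tau>" t] that unfolding J_def by (force intro!: continuous_intros)
    from this[OF m(1)] this[OF m(2)] show False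
      using ab by (auto simp: m_def)
  qed
  define c where "c = integral {0..l} (\<lambda>t. w t * \<omega> t) / I"
  define d where "d = integral {0..l} (\<lambda>t. (t - \<tau>) * w t * \<omega> t) / J"
  define \<theta> where "\<theta> t = (w t - (c + d * (t - \<tau>))) * \<omega> t" for t
  have \<tau>: "integral {0..l} (\<lambda>t. (t - \<tau>) * \<omega> t) = 0"
  proof -
    have "integral {0..l} (\<lambda>t. (t - \<tau>) * \<omega> t) = integral {0..l} (\<lambda>t. t * \<omega> t - (\<tau> * \<omega> t + 0 * \<omega> t))"
      by (rule arg_cong[where f="integral {0..l}"]) (simp add: left_diff_distrib)
    also have "\<dots> = integral {0..l} (\<lambda>t. t * \<omega> t) - (\<tau> * I + 0 * I)"
      unfolding I_def by (intro lin c\<omega> continuous_intros)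
    also have "\<dots> = 0"
      using I by (simp add: \<tau>_def)
    finally show ?thesis .
  qed
  have c\<theta>: "continuous_on S \<theta>" for S
    unfolding \<theta>_def by (intro cw c\<omega> continuous_intros)
  have \<theta>1: "integral {0..l} \<theta> = 0"
  proof -
    have "integral {0..l} \<theta> = integral {0..l} (\<lambda>t. w t * \<omega> t - (c * \<omega> t + d * ((t - \<tau>) * \<omega> t)))"
      by (rule arg_cong[where f="integral {0..l}"]) (auto simp: \<theta>_def left_diff_distrib distrib_right)
    also have "\<dots> = integral {0..l} (\<lambda>t. w t * \<omega> t)
        - (c * integral {0..l} \<omega> + d * integral {0..l} (\<lambda>t. (t - \<tau>) * \<omega> t))"
      by (intro lin cw c\<omega> continuous_intros)
    also have "\<dots> = 0"
      using I unfolding \<tau> c_def I_def by simp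
    finally show ?thesis .
  qed
  have \<theta>2: "integral {0..l} (\<lambda>t. (t - \<tau>) * \<theta> t) = 0"
  proof -
    have "integral {0..l} (\<lambda>t. (t - \<tau>) * \<theta> t)
        = integral {0..l} (\<lambda>t. (t - \<tau>) * w t * \<omega> t - (c * ((t - \<tau>) * \<omega> t) + d * ((t - \<tau>)\<^sup>2 * \<omega> t)))"
      unfolding \<theta>_def power2_eq_square by (intro arg_cong[where f="integral {0..l}"] ext) algebra
    also have "\<dots> = integral {0..l} (\<lambda>t. (t - \<tau>) * w t * \<omega> t)
        - (c * integral {0..l} (\<lambda>t. (t - \<tau>) * \<omega> t) + d * J)"
      unfolding J_def by (intro lin cw c\<omega> continuous_intros)
    also have "\<dots> = 0"
      using J unfolding \<tau> d_def by simp
    finally show ?thesis .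
  qed
  have \<theta>3: "integral {0..l} (\<lambda>t. t * \<theta> t) = 0"
  proof -
    have "integral {0..l} (\<lambda>t. t * \<theta> t) = integral {0..l} (\<lambda>t. (t - \<tau>) * \<theta> t - ((- \<tau>) * \<theta> t + 0 * \<theta> t))"
      by (rule arg_cong[where f="integral {0..l}"]) (simp add: left_diff_distrib)
    also have "\<dots> = integral {0..l} (\<lambda>t. (t - \<tau>) * \<theta> t)
        - ((- \<tau>) * integral {0..l} \<theta> + 0 * integral {0..l} \<theta>)"
      by (intro lin c\<theta> continuous_intros)
    finally show ?thesis
      unfolding \<theta>1 \<theta>2 by simp
  qed
  have "integral {0..l} (\<lambda>t. z t * \<theta> t) = 0"
    using ann[of \<theta>] c\<theta> supp \<theta>1 \<theta>3 by (simp add: \<theta>_def)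
  then have \<theta>4: "integral {0..l} (\<lambda>t. w t * \<theta> t) = 0"
    by (subst Henstock_Kurzweil_Integration.integral_cong[of _ _ "\<lambda>t. z t * \<theta> t"]) (auto simp: w_def min_def max_def)
  \<comment> \<open>As \<theta> is orthogonal to affine functions, the weighted squared norm of the
    residual reduces to \<integral> w \<theta>, which vanishes by \<open>ann\<close>.\<close>
  have "integral {0..l} (\<lambda>t. (w t - (c + d * (t - \<tau>)))\<^sup>2 * \<omega> t)
      = integral {0..l} (\<lambda>t. w t * \<theta> t - (c * \<theta> t + d * ((t - \<tau>) * \<theta> t)))"
    unfolding \<theta>_def power2_eq_square by (intro arg_cong[where f="integral {0..l}"] ext) algebra
  also have "\<dots> = integral {0..l} (\<lambda>t. w t * \<theta> t)
      - (c * integral {0..l} \<theta> + d * integral {0..l} (\<lambda>t. (t - \<tau>) * \<theta> t))"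
    by (intro lin cw c\<theta> continuous_intros)
  finally have proj: "integral {0..l} (\<lambda>t. (w t - (c + d * (t - \<tau>)))\<^sup>2 * \<omega> t) = 0"
    unfolding \<theta>1 \<theta>2 \<theta>4 by simp
  have "w t - (c + d * (t - \<tau>)) = 0" if "t \<in> {a<..<b}" for t
    by (rule zeroD[OF proj _ that]) (intro cw continuous_intros)
  then have "z t = (c - d * \<tau>) + d * t" if "t \<in> {a<..<b}" for t
    using that ab by (force simp: w_def algebra_simps)
  then show ?thesis
    by blast
qed

text \<open>The function u + t^2 / 2 is affine on every (a, b) with 0 < a < b < l. Intervals sharing
  two fixed points have the same coefficients, and continuity extends the formula to 0 and l, where
  the coefficients are read off.\<close>

lemma weak_solution_quadratic:
  fixes u :: "real \<Rightarrow> real"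
  assumes l: "0 < l" and u: "continuous_on {0..l} u"
    and H: "H1 l u u'" "H1 l u' u''" and ae: "AE t in lebesgue_on {0<..<l}. - u'' t = 1"
    and t: "t \<in> {0..l}"
  shows "u t = u 0 + (u l - u 0) * t / l + t * (l - t) / 2"
proof -
  define z where "z t = u t + t\<^sup>2 / 2" for t
  have z: "continuous_on {0..l} z"
    unfolding z_def using u by (intro continuous_intros) auto
  have aff: "\<exists>\<alpha> \<beta>. \<forall>t\<in>{a<..<b}. z t = \<alpha> + \<beta> * t" if "0 < a" "a < b" "b < l" for a b
  proof (rule affine_if_annihilates[OF z that])
    fix \<theta>
    assume "continuous_on UNIV \<theta>" "\<And>t. t \<notin> {a<..<b} \<Longrightarrow> \<theta> t = 0"
      "integral {0..l} \<theta> = 0" "integral {0..l} (\<lambda>t. t * \<theta> t) = 0"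
    then show "integral {0..l} (\<lambda>t. z t * \<theta> t) = 0"
      unfolding z_def by (intro weak_solution_annihilates[OF l u H ae _ _ that])
  qed
  \<comment> \<open>The line through \<open>z\<close> at two fixed interior points gives
    coefficients independent of (a, b).\<close>
  define p where "p = l / 3"
  define q where "q = 2 * l / 3"
  define \<beta> where "\<beta> = (z q - z p) / (q - p)"
  define \<alpha> where "\<alpha> = z p - \<beta> * p"
  have in_Ioo: "z t = \<alpha> + \<beta> * t" if t: "t \<in> {0<..<l}" for t
  proof -
    \<comment> \<open>The interval (a, b) is chosen to contain \<open>p\<close>, \<open>q\<close>
      and \<open>t\<close> while staying away from 0 and l.\<close>
    define a where "a = min p t / 2"
    define b where "b = (max q t + l) / 2"
    have ab: "0 < a" "a < b" "b < l" "t \<in> {a<..<b}" "p \<in> {a<..<b}" "q \<in> {a<..<b}" "p < q"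
      using t l by (auto simp: a_def b_def p_def q_def min_def max_def field_simps)
    obtain \<alpha>' \<beta>' where ab': "\<forall>t\<in>{a<..<b}. z t = \<alpha>' + \<beta>' * t"
      using aff[OF ab(1-3)] by blast
    then have e: "z t = \<alpha>' + \<beta>' * t" "z p = \<alpha>' + \<beta>' * p" "z q = \<alpha>' + \<beta>' * q"
      using ab by auto
    then have "\<beta> = \<beta>'"
      using ab(7) by (simp add: \<beta>_def field_simps)
    then show ?thesis
      using e by (simp add: \<alpha>_def)
  qed
  have all: "z t - (\<alpha> + \<beta> * t) = 0" if "t \<in> {0..l}" for t
  proof -
    have cl: "closure {0<..<l} = {0..l}"
      using l by simp
    show ?thesis
      by (rule continuous_constant_on_closure[where S="{0<..<l}" and f="\<lambda>t. z t - (\<alpha> + \<beta> * t)"])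
        (use cl that in_Ioo in \<open>auto intro!: continuous_intros z\<close>)
  qed
  have u0: "u 0 = \<alpha>" and ul: "u l = \<alpha> + \<beta> * l - l\<^sup>2 / 2" and ut: "u t = \<alpha> + \<beta> * t - t\<^sup>2 / 2"
    using all[of 0] all[of l] all[OF t] l by (auto simp: z_def)
  have "(u l - u 0) * t / l = (\<beta> - l / 2) * t"
    using l by (simp add: u0 ul field_simps power2_eq_square)
  then show ?thesis
    unfolding u0 ut by (simp add: field_simps power2_eq_square)
qed

section \<open>Points and distances\<close>

lemma joined_nonneg: "joined G p q L \<Longrightarrow> 0 \<le> L"
  by (induction rule: joined.induct) auto

lemma path_dist_le: "joined G p q L \<Longrightarrow> path_dist G p q \<le> L"
  unfolding path_dist_def by (rule cInf_lower) (auto intro!: bdd_belowI[of _ 0] joined_nonneg)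

lemma edge_point_in_points: "e \<in> edges G \<Longrightarrow> t \<in> {0..len G e} \<Longrightarrow> edge_point G e t \<in> points G"
  unfolding points_def by blast

lemma joined_edge:
  assumes "e \<in> edges G" "s \<in> {0..len G e}" "t \<in> {0..len G e}"
  shows "joined G (edge_point G e s) (edge_point G e t) \<bar>t - s\<bar>"
  using joined.step[OF joined.refl[OF edge_point_in_points[OF assms(1,2)]] assms] by simp

lemma joined_trans:
  assumes "joined G q r M" "joined G p q L"
  shows "joined G p r (L + M)"
  using assms
proof (induction rule: joined.induct)
  case (step q e s M t)
  then show ?case
    using joined.step[of G p e s "L + M" t] by (simp add: add.assoc)
qed simp

lemma joined_sym: "joined G p q L \<Longrightarrow> joined G q p L"
proof (induction rule: joined.induct)
  case (step p e s L t)
  then show ?case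
    using joined_trans[OF step.IH joined_edge[of e G t s]] by (simp add: abs_minus_commute add.commute)
qed (rule joined.refl)

lemma path_dist_edge_le:
  assumes "e \<in> edges G" "s \<in> {0..len G e}" "t \<in> {0..len G e}"
  shows "path_dist G (edge_point G e s) (edge_point G e t) \<le> \<bar>t - s\<bar>"
  using path_dist_le[OF joined_edge[OF assms]] .

lemma edge_point_0: "edge_point G e 0 = Vertex (tail G e)"
  by (simp add: edge_point_def)

context compact_connected_metric_graph
begin

lemma edge_point_len: "e \<in> edges G \<Longrightarrow> edge_point G e (len G e) = Vertex (head G e)"
  using len_pos[of e] by (simp add: edge_point_def)

lemma points_cases:
  assumes "p \<in> points G"
  obtains x where "x \<in> verts G" "p = Vertex x"
    | e t where "e \<in> edges G" "0 < t" "t < len G e" "p = Interior e t"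
proof -
  have "(\<exists>x\<in>verts G. p = Vertex x) \<or> (\<exists>e\<in>edges G. \<exists>t\<in>{0..len G e}. p = edge_point G e t)"
    using assms unfolding points_def by auto
  then show thesis
  proof (elim disjE bexE)
    fix x assume "x \<in> verts G" "p = Vertex x"
    then show thesis by (rule that(1))
  next
    fix e t assume e: "e \<in> edges G" and t: "t \<in> {0..len G e}" and p: "p = edge_point G e t"
    consider "t = 0" | "t = len G e" | "0 < t" "t < len G e"
      using t by fastforce
    then show thesis
    proof cases
      case 1
      show ?thesis
        by (rule that(1)[OF tail_in_verts[OF e]]) (simp add: p 1 edge_point_0)
    next
      case 2
      show ?thesis
        by (rule that(1)[OF head_in_verts[OF e]]) (simp add: p 2 edge_point_len e)
    next
      case 3
      show ?thesis
        by (rule that(2)[OF e 3]) (use 3 in \<open>simp add: p edge_point_def\<close>)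
    qed
  qed
qed

lemma edge_point_Interior:
  "0 < t \<Longrightarrow> t < len G e \<Longrightarrow> edge_point G e t = Interior e t"
  by (simp add: edge_point_def)

lemma joined_edge_ends:
  assumes "e \<in> edges G"
  shows "joined G (Vertex (tail G e)) (Vertex (head G e)) (len G e)"
  using joined_edge[OF assms, of 0 "len G e"] len_pos[OF assms]
  by (simp add: edge_point_0 edge_point_len assms)

lemma vertices_joined:
  assumes "x \<in> verts G" "y \<in> verts G"
  shows "\<exists>L. joined G (Vertex x) (Vertex y) L"
  using connected_verts[OF assms]
proof (induction rule: rtrancl_induct)
  case base
  then show ?case
    using joined.refl[of "Vertex x" G] assms(1) by (auto simp: points_def)
next
  case (step y z)
  from step(2) obtain L where "joined G (Vertex y) (Vertex z) L"
    unfolding adjacency_def using joined_edge_ends joined_sym by fastforce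
  then show ?case
    using step(3) joined_trans by blast
qed

lemma points_joined:
  assumes "p \<in> points G" "q \<in> points G"
  shows "\<exists>L. joined G p q L"
proof -
  have v: "\<exists>x\<in>verts G. \<exists>L. joined G (Vertex x) p L" if "p \<in> points G" for p
    using that
  proof (cases rule: points_cases)
    case (1 x)
    then show ?thesis using joined.refl[OF that] by blast
  next
    case (2 e t)
    then have "joined G (Vertex (tail G e)) p \<bar>t - 0\<bar>"
      using joined_edge[of e G 0 t] by (simp add: edge_point_0 edge_point_Interior)
    then show ?thesis using tail_in_verts 2 by blast
  qed
  then show ?thesis
    using assms vertices_joined joined_sym joined_trans by meson
qed

text \<open>The bound on edges adds up over the segments of a path, so values at its ends differ by
  at most C times its length. A distance below \<delta> yields a path shorter than \<delta>, because
  the infimum is over a non-empty set of lengths.\<close>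

lemma Lipschitz_imp_continuous_on_graph:
  assumes u: "\<And>e s t. \<lbrakk>e \<in> edges G; s \<in> {0..len G e}; t \<in> {0..len G e}\<rbrakk>
      \<Longrightarrow> \<bar>u (edge_point G e t) - u (edge_point G e s)\<bar> \<le> C * \<bar>t - s\<bar>" and "0 \<le> C"
  shows "continuous_on_graph G u"
proof -
  have L: "\<bar>u q - u p\<bar> \<le> C * L" if "joined G p q L" for p q L
    using that
  proof (induction rule: joined.induct)
    case (step p e s L t)
    then show ?case
      using u[of e s t] by (simp add: distrib_left)
  qed simp
  show ?thesis
    unfolding continuous_on_graph_def
  proof (intro ballI allI impI)
    fix p and \<epsilon> :: real assume p: "p \<in> points G" and "0 < \<epsilon>"
    show "\<exists>\<delta>>0. \<forall>q\<in>points G. path_dist G p q < \<delta> \<longrightarrow> \<bar>u q - u p\<bar> < \<epsilon>"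
    \<comment> \<open>Dividing by C + 1 instead of C covers C = 0.\<close>
    proof (intro exI[of _ "\<epsilon> / (C + 1)"] conjI ballI impI)
      fix q assume q: "q \<in> points G" and d: "path_dist G p q < \<epsilon> / (C + 1)"
      from points_joined[OF p q] have "{L. joined G p q L} \<noteq> {}"
        by blast
      from cInf_lessD[OF this d[unfolded path_dist_def]]
      obtain K where K: "joined G p q K" "K < \<epsilon> / (C + 1)"
        by blast
      have "\<bar>u q - u p\<bar> \<le> (C + 1) * K"
        using L[OF K(1)] joined_nonneg[OF K(1)] by (simp add: distrib_right)
      also have "\<dots> < \<epsilon>"
        using K(2) \<open>0 \<le> C\<close> by (simp add: field_simps)
      finally show "\<bar>u q - u p\<bar> < \<epsilon>" .
    qed (use \<open>0 < \<epsilon>\<close> \<open>0 \<le> C\<close> in auto)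
  qed
qed

text \<open>Parametrising an edge does not increase distances, so a \<delta> for the graph also
  serves on the interval.\<close>

lemma continuous_on_graph_imp_on_edge:
  assumes u: "continuous_on_graph G u" and e: "e \<in> edges G"
  shows "continuous_on {0..len G e} (on_edge G u e)"
  unfolding continuous_on_iff
proof (intro ballI allI impI)
  fix s and \<epsilon> :: real assume s: "s \<in> {0..len G e}" and "0 < \<epsilon>"
  then obtain \<delta> where "0 < \<delta>"
    "\<And>q. q \<in> points G \<Longrightarrow> path_dist G (edge_point G e s) q < \<delta> \<Longrightarrow> \<bar>u q - u (edge_point G e s)\<bar> < \<epsilon>"
    using u edge_point_in_points[OF e s] unfolding continuous_on_graph_def by blast
  then show "\<exists>\<delta>>0. \<forall>t\<in>{0..len G e}. dist t s < \<delta> \<longrightarrow> dist (on_edge G u e t) (on_edge G u e s) < \<epsilon>"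
    using path_dist_edge_le[OF e s] edge_point_in_points[OF e]
    by (intro exI[of _ \<delta>]) (force simp: dist_real_def on_edge_def)
qed

end

section \<open>Reduction to a problem on the vertices\<close>

definition edge_profile :: "real \<Rightarrow> real \<Rightarrow> real \<Rightarrow> real \<Rightarrow> real" where
  "edge_profile l a b t = a + (b - a) * t / l + t * (l - t) / 2"

lemma edge_profile_0 [simp]: "edge_profile l a b 0 = a"
  by (simp add: edge_profile_def)

lemma edge_profile_len [simp]: "l \<noteq> 0 \<Longrightarrow> edge_profile l a b l = b"
  by (simp add: edge_profile_def)

lemma edge_profile_alt: "edge_profile l a b t = a + (b - a) / l * t + (l * t - t\<^sup>2) / 2"
  by (simp add: edge_profile_def right_diff_distrib power2_eq_square mult.commute)

lemma edge_profile_has_derivative: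
  "(edge_profile l a b has_real_derivative (b - a) / l + l / 2 - t) (at t)"
proof -
  have "((\<lambda>t. a + (b - a) / l * t + (l * t - t\<^sup>2) / 2) has_real_derivative (b - a) / l + l / 2 - t) (at t)"
    by (auto intro!: derivative_eq_intros simp: diff_divide_distrib)
  moreover have "edge_profile l a b = (\<lambda>t. a + (b - a) / l * t + (l * t - t\<^sup>2) / 2)"
    by (simp add: edge_profile_alt fun_eq_iff)
  ultimately show ?thesis
    by simp
qed

lemma edge_profile_H2:
  assumes "0 < l"
  shows "H1 l (edge_profile l a b) (\<lambda>t. (b - a) / l + l / 2 - t)"
    and "H1 l (\<lambda>t. (b - a) / l + l / 2 - t) (\<lambda>_. - 1)"
proof -
  have "continuous_on UNIV (\<lambda>t. (b - a) / l + l / 2 - t)"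
    by (intro continuous_intros)
  from C1_imp_H1[OF edge_profile_has_derivative this assms]
  show "H1 l (edge_profile l a b) (\<lambda>t. (b - a) / l + l / 2 - t)" .
  have "((\<lambda>t. (b - a) / l + l / 2 - t) has_real_derivative - 1) (at t)" for t
    by (auto intro!: derivative_eq_intros)
  from C1_imp_H1[OF this continuous_on_const assms]
  show "H1 l (\<lambda>t. (b - a) / l + l / 2 - t) (\<lambda>_. - 1)" .
qed

lemma edge_profile_Lipschitz:
  assumes "s \<in> {0..l}" "t \<in> {0..l}"
  shows "\<bar>edge_profile l a b t - edge_profile l a b s\<bar> \<le> (\<bar>b - a\<bar> / l + l) * \<bar>t - s\<bar>"
proof -
  have "(a + c * t + (l * t - t\<^sup>2) / 2) - (a + c * s + (l * s - s\<^sup>2) / 2) = (c + (l - (t + s)) / 2) * (t - s)" for c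
    by (simp add: field_simps power2_eq_square)
  then have "edge_profile l a b t - edge_profile l a b s = ((b - a) / l + (l - (t + s)) / 2) * (t - s)"
    unfolding edge_profile_alt .
  moreover have "\<bar>(b - a) / l + (l - (t + s)) / 2\<bar> \<le> \<bar>b - a\<bar> / l + l"
  proof -
    have "\<bar>(l - (t + s)) / 2\<bar> \<le> l"
      using assms by auto
    moreover have "\<bar>(b - a) / l\<bar> = \<bar>b - a\<bar> / l"
      using assms by simp
    ultimately show ?thesis by linarith
  qed
  ultimately show ?thesis
    by (simp add: abs_mult mult_right_mono)
qed

lemma integral_edge_profile:
  assumes "0 < l"
  shows "(LINT t|lebesgue_on {0..l}. edge_profile l a b t) = l * (a + b) / 2 + l ^ 3 / 12"
proof -
  define F where "F t = a * t + (b - a) / l * (t\<^sup>2 / 2) + (l * (t\<^sup>2 / 2) - t ^ 3 / 3) / 2" for t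
  have "(F has_real_derivative a + (b - a) / l * t + (l * t - t\<^sup>2) / 2) (at t)" for t
    unfolding F_def using assms by (auto intro!: derivative_eq_intros simp: field_simps)
  then have d: "(F has_real_derivative edge_profile l a b t) (at t)" for t
    by (simp only: edge_profile_alt)
  have "(edge_profile l a b has_integral F l - F 0) {0..l}"
    using assms d
    by (intro fundamental_theorem_of_calculus[where f=F])
       (auto simp: has_real_derivative_iff_has_vector_derivative[symmetric]
         intro: has_field_derivative_at_within)
  then have "integral {0..l} (edge_profile l a b) = F l - F 0"
    by (rule integral_unique)
  moreover have "(LINT t|lebesgue_on {0..l}. edge_profile l a b t) = integral {0..l} (edge_profile l a b)"
    by (intro lebesgue_integral_eq_integral continuous_imp_integrable_real
        has_real_derivative_imp_continuous_on[OF edge_profile_has_derivative]) auto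
  moreover have "F l - F 0 = l * (a + b) / 2 + l ^ 3 / 12"
    using assms by (simp add: F_def field_simps power2_eq_square power3_eq_cube)
  ultimately show ?thesis by simp
qed

section \<open>Torsion functions and their vertex values\<close>

definition graph_function :: "('v, 'e) metric_graph \<Rightarrow> ('v \<Rightarrow> real) \<Rightarrow> ('v, 'e) point \<Rightarrow> real" where
  "graph_function G f = restrict (\<lambda>p. case p of Vertex x \<Rightarrow> f x
     | Interior e t \<Rightarrow> edge_profile (len G e) (f (tail G e)) (f (head G e)) t) (points G)"

definition slope :: "('v, 'e) metric_graph \<Rightarrow> ('v \<Rightarrow> real) \<Rightarrow> 'e \<Rightarrow> real" where
  "slope G f e = (f (head G e) - f (tail G e)) / len G e"

text \<open>The summands are the derivatives of the edge profile at the tail and at the head, both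
  pointing into the edge. This is the vertex condition of the torsion function in terms of vertex
  values alone.\<close>

definition kirchhoff :: "('v, 'e) metric_graph \<Rightarrow> 'v set \<Rightarrow> ('v \<Rightarrow> real) \<Rightarrow> bool" where
  "kirchhoff G D f \<longleftrightarrow> (\<forall>x\<in>D. f x = 0) \<and>
     (\<forall>x\<in>verts G - D. (\<Sum>e | e \<in> edges G \<and> tail G e = x. slope G f e + len G e / 2) +
        (\<Sum>e | e \<in> edges G \<and> head G e = x. - slope G f e + len G e / 2) = 0)"

context compact_connected_metric_graph
begin

lemma on_edge_graph_function:
  assumes "e \<in> edges G" "t \<in> {0..len G e}"
  shows "on_edge G (graph_function G f) e t = edge_profile (len G e) (f (tail G e)) (f (head G e)) t"
  using edge_point_in_points[OF assms] assms len_pos[OF assms(1)]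
  by (auto simp: on_edge_def graph_function_def edge_point_def)

lemma on_edge_torsion_function:
  assumes u: "is_torsion_function G D u" and e: "e \<in> edges G" and t: "t \<in> {0..len G e}"
  shows "on_edge G u e t = edge_profile (len G e) (u (Vertex (tail G e))) (u (Vertex (head G e))) t"
proof -
  from u e obtain u' u'' where w: "H1 (len G e) (on_edge G u e) u'" "H1 (len G e) u' u''"
      "AE t in lebesgue_on {0<..<len G e}. - u'' t = 1"
    unfolding is_torsion_function_def by blast
  have "continuous_on {0..len G e} (on_edge G u e)"
    using u e continuous_on_graph_imp_on_edge unfolding is_torsion_function_def by blast
  from weak_solution_quadratic[OF len_pos[OF e] this w t]
  show ?thesis
    by (simp add: edge_profile_def on_edge_def edge_point_0 edge_point_len[OF e])
qed

lemma normal_derivative_sum_edge_profile: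
  assumes u: "\<And>e t. \<lbrakk>e \<in> edges G; t \<in> {0..len G e}\<rbrakk> \<Longrightarrow>
    on_edge G u e t = edge_profile (len G e) (f (tail G e)) (f (head G e)) t"
  shows "normal_derivative_sum G u x = (\<Sum>e | e \<in> edges G \<and> tail G e = x. slope G f e + len G e / 2) +
        (\<Sum>e | e \<in> edges G \<and> head G e = x. - slope G f e + len G e / 2)"
proof -
  have d: "vector_derivative (on_edge G u e) (at t within {0..len G e}) = slope G f e + len G e / 2 - t"
    if e: "e \<in> edges G" and t: "t \<in> {0..len G e}" for e t
  proof (rule vector_derivative_within_closed_interval[OF len_pos[OF e] t])
    have p: "(edge_profile (len G e) (f (tail G e)) (f (head G e)) has_vector_derivative
        slope G f e + len G e / 2 - t) (at t within {0..len G e})"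
      using edge_profile_has_derivative[of "len G e" "f (tail G e)" "f (head G e)" t]
      unfolding slope_def has_real_derivative_iff_has_vector_derivative
      by (rule has_vector_derivative_at_within)
    show "(on_edge G u e has_vector_derivative slope G f e + len G e / 2 - t) (at t within {0..len G e})"
      by (rule has_vector_derivative_transform[OF t _ p]) (rule u[OF e])
  qed
  have "(\<Sum>e | e \<in> edges G \<and> tail G e = x. vector_derivative (on_edge G u e) (at 0 within {0..len G e}))
      = (\<Sum>e | e \<in> edges G \<and> tail G e = x. slope G f e + len G e / 2)"
    by (rule sum.cong[OF HOL.refl]) (simp add: d less_imp_le[OF len_pos])
  moreover have "(\<Sum>e | e \<in> edges G \<and> head G e = x.
        - vector_derivative (on_edge G u e) (at (len G e) within {0..len G e}))
      = (\<Sum>e | e \<in> edges G \<and> head G e = x. - slope G f e + len G e / 2)"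
    by (rule sum.cong[OF HOL.refl]) (simp add: d less_imp_le[OF len_pos])
  ultimately show ?thesis
    unfolding normal_derivative_sum_def by (simp only:)
qed

lemma torsion_function_kirchhoff:
  assumes u: "is_torsion_function G D u"
  shows "kirchhoff G D (\<lambda>x. u (Vertex x))" "u = graph_function G (\<lambda>x. u (Vertex x))"
proof -
  show "kirchhoff G D (\<lambda>x. u (Vertex x))"
    using u normal_derivative_sum_edge_profile[OF on_edge_torsion_function[OF u]]
    unfolding kirchhoff_def is_torsion_function_def by auto
  show "u = graph_function G (\<lambda>x. u (Vertex x))"
  proof (rule extensionalityI[of _ "points G"])
    show "u p = graph_function G (\<lambda>x. u (Vertex x)) p" if p: "p \<in> points G" for p
      using p
    proof (cases rule: points_cases)
      case (1 x)
      then show ?thesis using p by (simp add: graph_function_def)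
    next
      case (2 e t)
      then show ?thesis
        using on_edge_torsion_function[OF u, of e t] on_edge_graph_function[of e t "\<lambda>x. u (Vertex x)"]
        by (simp add: on_edge_def edge_point_Interior)
    qed
    show "u \<in> extensional (points G)"
      using u unfolding is_torsion_function_def by blast
  qed (simp add: graph_function_def)
qed

lemma kirchhoff_imp_torsion_function:
  assumes f: "kirchhoff G D f" and D: "D \<subseteq> verts G"
  shows "is_torsion_function G D (graph_function G f)"
  unfolding is_torsion_function_def
proof (intro conjI ballI)
  show "graph_function G f \<in> extensional (points G)"
    by (simp add: graph_function_def)
  \<comment> \<open>\<open>C e\<close> is a Lipschitz constant of the profile on \<open>e\<close>;
    the sum over all edges dominates each of them and serves the whole graph.\<close>
  define C where "C e = \<bar>f (head G e) - f (tail G e)\<bar> / len G e + len G e" for e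
  have C: "0 \<le> C e" if "e \<in> edges G" for e
    using len_pos[OF that] by (simp add: C_def)
  have le: "C e \<le> sum C (edges G)" if "e \<in> edges G" for e
    using C that finite_edges by (intro member_le_sum) auto
  show "continuous_on_graph G (graph_function G f)"
  proof (rule Lipschitz_imp_continuous_on_graph)
    fix e s t assume e: "e \<in> edges G" and st: "s \<in> {0..len G e}" "t \<in> {0..len G e}"
    have "\<bar>on_edge G (graph_function G f) e t - on_edge G (graph_function G f) e s\<bar> \<le> C e * \<bar>t - s\<bar>"
      using e st edge_profile_Lipschitz[OF st] by (simp add: on_edge_graph_function C_def)
    also have "\<dots> \<le> sum C (edges G) * \<bar>t - s\<bar>"
      using le[OF e] by (simp add: mult_right_mono)
    finally show "\<bar>graph_function G f (edge_point G e t) - graph_function G f (edge_point G e s)\<bar>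
        \<le> sum C (edges G) * \<bar>t - s\<bar>"
      by (simp add: on_edge_def)
  qed (use C in \<open>simp add: sum_nonneg\<close>)
  show "\<exists>u' u''. H1 (len G e) (on_edge G (graph_function G f) e) u' \<and> H1 (len G e) u' u'' \<and>
        (AE t in lebesgue_on {0<..<len G e}. - u'' t = 1)" if e: "e \<in> edges G" for e
  proof -
    have "H1 (len G e) (on_edge G (graph_function G f) e) u'
        \<longleftrightarrow> H1 (len G e) (edge_profile (len G e) (f (tail G e)) (f (head G e))) u'" for u'
      by (rule H1_cong) (simp add: on_edge_graph_function e)
    then show ?thesis
      using edge_profile_H2[OF len_pos[OF e]] by fastforce
  qed
  show "graph_function G f (Vertex x) = 0" if "x \<in> D" for x
    using f D that by (auto simp: kirchhoff_def graph_function_def points_def)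
  show "normal_derivative_sum G (graph_function G f) x = 0" if "x \<in> verts G - D" for x
  proof -
    have "normal_derivative_sum G (graph_function G f) x
        = (\<Sum>e | e \<in> edges G \<and> tail G e = x. slope G f e + len G e / 2) +
          (\<Sum>e | e \<in> edges G \<and> head G e = x. - slope G f e + len G e / 2)"
      by (rule normal_derivative_sum_edge_profile) (rule on_edge_graph_function)
    then show ?thesis
      using f that unfolding kirchhoff_def by simp
  qed
qed

section \<open>Weak form, energy and uniqueness for the vertex problem\<close>

lemma sum_over_vertices:
  "(\<Sum>x\<in>verts G. g x * ((\<Sum>e | e \<in> edges G \<and> tail G e = x. A e) + (\<Sum>e | e \<in> edges G \<and> head G e = x. B e)))
    = (\<Sum>e\<in>edges G. g (tail G e) * A e + g (head G e) * B e)" for g :: "'v \<Rightarrow> real"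
proof -
  have *: "(\<Sum>x\<in>verts G. g x * (\<Sum>e | e \<in> edges G \<and> h e = x. A e)) = (\<Sum>e\<in>edges G. g (h e) * A e)"
    if "\<And>e. e \<in> edges G \<Longrightarrow> h e \<in> verts G" for h :: "'e \<Rightarrow> 'v" and A
  proof -
    have "(\<Sum>x\<in>verts G. g x * (\<Sum>e | e \<in> edges G \<and> h e = x. A e))
        = (\<Sum>x\<in>verts G. \<Sum>e | e \<in> edges G \<and> h e = x. g (h e) * A e)"
      by (auto simp: sum_distrib_left intro!: sum.cong)
    also have "\<dots> = (\<Sum>e\<in>edges G. g (h e) * A e)"
      using that by (intro sum.group finite_edges finite_verts) auto
    finally show ?thesis .
  qed
  show ?thesis
    by (simp add: distrib_left sum.distrib *[OF tail_in_verts] *[OF head_in_verts])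
qed

text \<open>Summation by parts: the vertex conditions are multiplied by g and regrouped by edges.
  The result is the weak equation \<integral> u' g' = \<integral> g, with g extended affinely along
  each edge.\<close>

lemma kirchhoff_weak:
  assumes f: "kirchhoff G D f" and g: "\<And>x. x \<in> D \<Longrightarrow> g x = 0"
  shows "(\<Sum>e\<in>edges G. slope G f e * (g (head G e) - g (tail G e)))
    = (\<Sum>e\<in>edges G. len G e * (g (tail G e) + g (head G e)) / 2)"
proof -
  have "0 = (\<Sum>x\<in>verts G. g x * ((\<Sum>e | e \<in> edges G \<and> tail G e = x. slope G f e + len G e / 2) +
        (\<Sum>e | e \<in> edges G \<and> head G e = x. - slope G f e + len G e / 2)))"
    using f g unfolding kirchhoff_def by (intro sum.neutral[symmetric]) auto
  also have "\<dots> = (\<Sum>e\<in>edges G. g (tail G e) * (slope G f e + len G e / 2)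
      + g (head G e) * (- slope G f e + len G e / 2))"
    by (rule sum_over_vertices)
  also have "\<dots> = (\<Sum>e\<in>edges G. len G e * (g (tail G e) + g (head G e)) / 2
      - slope G f e * (g (head G e) - g (tail G e)))"
    by (intro sum.cong) (auto simp: field_simps)
  finally show ?thesis
    by (simp add: sum_subtractf)
qed

text \<open>The energy is a sum of squares divided by lengths, so k agrees at the two ends of every
  edge, and connectedness carries the value 0 from a Dirichlet vertex to x.\<close>

lemma zero_if_no_energy:
  assumes D: "D \<subseteq> verts G" "D \<noteq> {}" and k: "\<And>x. x \<in> D \<Longrightarrow> k x = 0"
    and en: "(\<Sum>e\<in>edges G. slope G k e * (k (head G e) - k (tail G e))) = 0" and x: "x \<in> verts G"
  shows "k x = 0"
proof -
  have eq: "k (tail G e) = k (head G e)" if e: "e \<in> edges G" for e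
  proof -
    have "slope G k e * (k (head G e) - k (tail G e)) = (k (head G e) - k (tail G e))\<^sup>2 / len G e" for e
      by (simp add: slope_def power2_eq_square)
    moreover have "(k (head G e) - k (tail G e))\<^sup>2 / len G e \<ge> 0" if "e \<in> edges G" for e
      using len_pos[OF that] by simp
    ultimately have "(k (head G e) - k (tail G e))\<^sup>2 / len G e = 0"
      using en e finite_edges by (simp add: sum_nonneg_eq_0_iff)
    then show ?thesis
      using len_pos[OF e] by simp
  qed
  obtain y where y: "y \<in> D"
    using D by blast
  have "(x, y) \<in> (adjacency G)\<^sup>*"
    using connected_verts x y D by blast
  then have "k x = k y"
    by (induction rule: rtrancl_induct) (auto simp: adjacency_def eq)
  then show ?thesis
    using k[OF y] by simp
qed

text \<open>Both weak equations, tested with the difference k, have the same right-hand side, so k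
  has no energy.\<close>

lemma kirchhoff_unique:
  assumes D: "D \<subseteq> verts G" "D \<noteq> {}" and f: "kirchhoff G D f" and g: "kirchhoff G D g"
    and x: "x \<in> verts G"
  shows "f x = g x"
proof -
  define k where "k x = f x - g x" for x
  have k: "k x = 0" if "x \<in> D" for x
    using that f g by (simp add: k_def kirchhoff_def)
  have "slope G k e = slope G f e - slope G g e" for e
    by (simp add: slope_def k_def diff_divide_distrib)
  then have "(\<Sum>e\<in>edges G. slope G k e * (k (head G e) - k (tail G e))) = 0"
    using kirchhoff_weak[OF f, of k] kirchhoff_weak[OF g, of k] k
    by (simp add: left_diff_distrib sum_subtractf)
  from zero_if_no_energy[OF D k this x] show ?thesis
    by (simp add: k_def)
qed

end

text \<open>
  Adding a point \<open>a\<close> to the set where the equation holds amounts to adding a multiple of the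
  function that is \<open>1\<close> at \<open>a\<close> and solves the homogeneous equation at the other points.
\<close>

lemma linear_system_solvable:
  fixes L :: "('v \<Rightarrow> real) \<Rightarrow> 'v \<Rightarrow> real"
  assumes lin: "\<And>f g c x. L (\<lambda>y. f y + c * g y) x = L f x + c * L g x"
    and inj: "\<And>f x. \<lbrakk>\<And>x. x \<notin> S \<Longrightarrow> f x = 0; \<And>x. f x = 0 \<or> L f x = 0\<rbrakk> \<Longrightarrow> f x = 0"
    and S: "finite S"
  shows "\<exists>f. (\<forall>x. x \<notin> S \<longrightarrow> f x = 0) \<and> (\<forall>x\<in>S. L f x = b x)"
proof -
  have "\<exists>f. (\<forall>x. x \<notin> T \<longrightarrow> f x = 0) \<and> (\<forall>x\<in>T. L f x = b x)" if "finite T" "T \<subseteq> S" for T b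
    using that
  proof (induction T arbitrary: b rule: finite_induct)
    case empty
    show ?case by (rule exI[of _ "\<lambda>_. 0"]) simp
  next
    case (insert a T)
    define \<delta> where "\<delta> x = (if x = a then 1 else 0 :: real)" for x
    have T: "T \<subseteq> S"
      using insert.prems by blast
    from insert.IH[OF T, of b] obtain f0
      where f0: "\<And>x. x \<notin> T \<Longrightarrow> f0 x = 0" "\<And>x. x \<in> T \<Longrightarrow> L f0 x = b x"
      by blast
    \<comment> \<open>Here \<open>k\<close> cancels \<open>L \<delta>\<close> on \<open>T\<close>,
      so that \<open>w\<close> = \<open>k\<close> + \<delta> solves the homogeneous equation there.
      This second right-hand side is why \<open>b\<close> is arbitrary in the induction.\<close>
    from insert.IH[OF T, of "\<lambda>x. - L \<delta> x"] obtain k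
      where k: "\<And>x. x \<notin> T \<Longrightarrow> k x = 0" "\<And>x. x \<in> T \<Longrightarrow> L k x = - L \<delta> x"
      by blast
    define w where "w x = k x + 1 * \<delta> x" for x
    have w: "L w x = 0" if "x \<in> T" for x
      using k(2)[OF that] lin[of k 1 \<delta> x] unfolding w_def by simp
    have wa: "w a = 1" and w0: "\<And>x. x \<notin> insert a T \<Longrightarrow> w x = 0"
      using k(1) insert.hyps by (auto simp: w_def \<delta>_def)
    have "L w a \<noteq> 0"
    proof
      assume "L w a = 0"
      \<comment> \<open>The pointwise alternative in \<open>inj\<close> makes it applicable to
        functions supported on any \<open>insert a T\<close> within \<open>S\<close>.\<close>
      then have "w x = 0 \<or> L w x = 0" for x
        using w w0 by (cases "x \<in> insert a T") auto
      moreover have "w x = 0" if "x \<notin> S" for x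
        using that w0 insert.prems by blast
      ultimately have "w a = 0"
        by (intro inj[of w a])
      then show False
        using wa by simp
    qed
    \<comment> \<open>This multiple of \<open>w\<close> removes the error at \<open>a\<close> and
      leaves the equations on \<open>T\<close> intact, as \<open>L w\<close> vanishes there.\<close>
    define c where "c = (b a - L f0 a) / L w a"
    show ?case
    proof (intro exI[of _ "\<lambda>x. f0 x + c * w x"] conjI allI impI ballI)
      show "f0 x + c * w x = 0" if "x \<notin> insert a T" for x
        using that f0 w0 by simp
      show "L (\<lambda>x. f0 x + c * w x) x = b x" if "x \<in> insert a T" for x
        unfolding lin c_def using that f0(2) w \<open>L w a \<noteq> 0\<close> by auto
    qed
  qed
  from this[OF S subset_refl] show ?thesis .
qed

section \<open>Existence of the torsion function and the value of the rigidity\<close>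

context compact_connected_metric_graph
begin

lemma kirchhoff_exists:
  assumes D: "D \<subseteq> verts G" "D \<noteq> {}"
  shows "\<exists>f. kirchhoff G D f"
proof -
  \<comment> \<open>\<open>L\<close> is the part of the vertex condition that is linear in f;
    \<open>b\<close> is minus the contribution of the edge lengths.\<close>
  define L where "L f x = (\<Sum>e | e \<in> edges G \<and> tail G e = x. slope G f e) +
        (\<Sum>e | e \<in> edges G \<and> head G e = x. - slope G f e)" for f x
  define b where "b x = - ((\<Sum>e | e \<in> edges G \<and> tail G e = x. len G e / 2) +
        (\<Sum>e | e \<in> edges G \<and> head G e = x. len G e / 2))" for x
  have "\<exists>f. (\<forall>x. x \<notin> verts G - D \<longrightarrow> f x = 0) \<and> (\<forall>x\<in>verts G - D. L f x = b x)"
  proof (rule linear_system_solvable)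
    show "L (\<lambda>y. f y + c * g y) x = L f x + c * L g x" for f g c x
    proof -
      have "slope G (\<lambda>y. f y + c * g y) e = slope G f e + c * slope G g e" for e
        by (simp add: slope_def field_simps diff_divide_distrib add_divide_distrib)
      then show ?thesis
        by (simp add: L_def sum.distrib sum_subtractf sum_negf sum_distrib_left distrib_left right_diff_distrib)
    qed
    show "finite (verts G - D)"
      using finite_verts by blast
    show "f x = 0" if "\<And>x. x \<notin> verts G - D \<Longrightarrow> f x = 0" "\<And>x. f x = 0 \<or> L f x = 0" for f x
    proof -
      \<comment> \<open>Summed over the vertices, these products give minus the energy of f, so f is
        a function without energy.\<close>
      have "f x * L f x = 0" for x
        using that(2)[of x] by auto
      then have "0 = (\<Sum>x\<in>verts G. f x * L f x)"
        by (intro sum.neutral[symmetric] ballI)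
      also have "\<dots> = (\<Sum>e\<in>edges G. f (tail G e) * slope G f e + f (head G e) * - slope G f e)"
        unfolding L_def by (rule sum_over_vertices)
      also have "\<dots> = (\<Sum>e\<in>edges G. - (slope G f e * (f (head G e) - f (tail G e))))"
        by (intro sum.cong) (auto simp: algebra_simps)
      also have "\<dots> = - (\<Sum>e\<in>edges G. slope G f e * (f (head G e) - f (tail G e)))"
        by (rule sum_negf)
      finally show ?thesis
        using zero_if_no_energy[OF D, of f x] that(1) by force
    qed
  qed
  then obtain f where f: "\<And>x. x \<notin> verts G - D \<Longrightarrow> f x = 0" "\<And>x. x \<in> verts G - D \<Longrightarrow> L f x = b x"
    by blast
  have "kirchhoff G D f"
    unfolding kirchhoff_def
  proof (intro conjI ballI)
    fix x assume "x \<in> verts G - D"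
    then show "(\<Sum>e | e \<in> edges G \<and> tail G e = x. slope G f e + len G e / 2) +
        (\<Sum>e | e \<in> edges G \<and> head G e = x. - slope G f e + len G e / 2) = 0"
      using f(2)[of x] unfolding L_def b_def sum.distrib by linarith
  qed (use f(1) in auto)
  then show ?thesis by blast
qed

lemma torsion_function_eq:
  assumes D: "D \<subseteq> verts G" "D \<noteq> {}" and f: "kirchhoff G D f"
  shows "torsion_function G D = graph_function G f"
  unfolding torsion_function_def
proof (rule the_equality)
  show "is_torsion_function G D (graph_function G f)"
    by (rule kirchhoff_imp_torsion_function[OF f D(1)])
  fix u assume u: "is_torsion_function G D u"
  have eq: "u (Vertex x) = f x" if "x \<in> verts G" for x
    using kirchhoff_unique[OF D torsion_function_kirchhoff(1)[OF u] f that] .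
  \<comment> \<open>Uniqueness concerns values at vertices of the graph only;
    \<open>graph_function\<close> depends on no others.\<close>
  have "graph_function G (\<lambda>x. u (Vertex x)) p = graph_function G f p" for p
  proof (cases "p \<in> points G")
    case True
    then show ?thesis
      by (cases rule: points_cases) (auto simp: graph_function_def eq tail_in_verts head_in_verts)
  qed (simp add: graph_function_def)
  then have "graph_function G (\<lambda>x. u (Vertex x)) = graph_function G f"
    by (rule ext)
  then show "u = graph_function G f"
    by (rule trans[OF torsion_function_kirchhoff(2)[OF u]])
qed

lemma torsional_rigidity_eq:
  assumes D: "D \<subseteq> verts G" "D \<noteq> {}" and f: "kirchhoff G D f"
  shows "torsional_rigidity G D = (\<Sum>e\<in>edges G. len G e * (f (tail G e) + f (head G e)) / 2 + len G e ^ 3 / 12)"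
  unfolding torsional_rigidity_def graph_integral_def torsion_function_eq[OF assms]
proof (rule sum.cong[OF HOL.refl])
  fix e assume e: "e \<in> edges G"
  have "(LINT t|lebesgue_on {0..len G e}. on_edge G (graph_function G f) e t)
      = (LINT t|lebesgue_on {0..len G e}. edge_profile (len G e) (f (tail G e)) (f (head G e)) t)"
    by (rule Bochner_Integration.integral_cong) (auto simp: on_edge_graph_function e)
  then show "(LINT t|lebesgue_on {0..len G e}. on_edge G (graph_function G f) e t)
      = len G e * (f (tail G e) + f (head G e)) / 2 + len G e ^ 3 / 12"
    by (simp add: integral_edge_profile len_pos e)
qed

text \<open>
  Dirichlet principle: \<open>T = max (2 \<integral> \<phi> - \<integral> \<phi>'\<^sup>2)\<close>. An edge on which \<open>\<phi>\<close> is the profile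
  between its end values contributes the summand below, an edge on which \<open>\<phi>\<close> is constant at
  least \<open>2 \<integral> \<phi>\<close>.
\<close>

lemma torsional_rigidity_ge:
  assumes D: "D \<subseteq> verts G" "D \<noteq> {}" and g: "\<And>x. x \<in> D \<Longrightarrow> g x = 0"
  shows "torsional_rigidity G D \<ge> (\<Sum>e\<in>edges G. len G e * (g (tail G e) + g (head G e))
    - (g (head G e) - g (tail G e))\<^sup>2 / len G e + len G e ^ 3 / 12)"
proof -
  obtain f where f: "kirchhoff G D f"
    using kirchhoff_exists[OF D] by blast
  define \<Delta> where "\<Delta> h e = h (head G e) - h (tail G e)" for h :: "'v \<Rightarrow> real" and e
  \<comment> \<open>This is 2ab - b^2 \<le> a^2 divided by the length. Summed and combined with the
    weak equation tested with f and with g, it compares the Dirichlet functional at g with its value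
    at the solution f.\<close>
  have "2 * (\<Delta> f e * \<Delta> g e / len G e) - (\<Delta> g e)\<^sup>2 / len G e \<le> (\<Delta> f e)\<^sup>2 / len G e" if "e \<in> edges G" for e
  proof -
    have "0 \<le> (\<Delta> f e - \<Delta> g e)\<^sup>2 / len G e"
      using len_pos[OF that] by simp
    then show ?thesis
      by (simp add: power2_diff diff_divide_distrib add_divide_distrib)
  qed
  then have "(\<Sum>e\<in>edges G. 2 * (\<Delta> f e * \<Delta> g e / len G e) - (\<Delta> g e)\<^sup>2 / len G e)
      \<le> (\<Sum>e\<in>edges G. (\<Delta> f e)\<^sup>2 / len G e)"
    by (rule sum_mono)
  moreover have "(\<Sum>e\<in>edges G. (\<Delta> f e)\<^sup>2 / len G e) = (\<Sum>e\<in>edges G. len G e * (f (tail G e) + f (head G e)) / 2)"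
    using kirchhoff_weak[OF f, of f] f
    by (simp add: \<Delta>_def slope_def power2_eq_square kirchhoff_def)
  moreover have "(\<Sum>e\<in>edges G. \<Delta> f e * \<Delta> g e / len G e) = (\<Sum>e\<in>edges G. len G e * (g (tail G e) + g (head G e)) / 2)"
    using kirchhoff_weak[OF f, of g] g
    by (simp add: \<Delta>_def slope_def)
  moreover have "(\<Sum>e\<in>edges G. 2 * (\<Delta> f e * \<Delta> g e / len G e) - (\<Delta> g e)\<^sup>2 / len G e)
      = 2 * (\<Sum>e\<in>edges G. \<Delta> f e * \<Delta> g e / len G e) - (\<Sum>e\<in>edges G. (\<Delta> g e)\<^sup>2 / len G e)"
    by (simp only: sum_subtractf sum_distrib_left)
  moreover have "(\<Sum>e\<in>edges G. len G e * (g (tail G e) + g (head G e)))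
      = 2 * (\<Sum>e\<in>edges G. len G e * (g (tail G e) + g (head G e)) / 2)"
    by (simp add: sum_distrib_left)
  ultimately show ?thesis
    unfolding torsional_rigidity_eq[OF D f] sum.distrib sum_subtractf \<Delta>_def by linarith
qed

end

section \<open>Walks\<close>

text \<open>The set of admissible edges is a parameter so that walks avoiding a given edge can be
  expressed.\<close>

fun walk :: "('v, 'e) metric_graph \<Rightarrow> 'e set \<Rightarrow> 'v \<Rightarrow> ('e \<times> bool) list \<Rightarrow> 'v \<Rightarrow> bool" where
  "walk G E x [] y \<longleftrightarrow> x = y"
| "walk G E x (d # ds) y \<longleftrightarrow> fst d \<in> E \<and> start_vertex G d = x \<and> walk G E (end_vertex G d) ds y"

definition walk_length :: "('v, 'e) metric_graph \<Rightarrow> ('e \<times> bool) list \<Rightarrow> real" where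
  "walk_length G ds = (\<Sum>d\<leftarrow>ds. len G (fst d))"

lemma walk_append:
  "walk G E x (as @ bs) z \<longleftrightarrow> (\<exists>y. walk G E x as y \<and> walk G E y bs z)"
  by (induction as arbitrary: x) auto

lemma walk_mono: "walk G E x ds y \<Longrightarrow> E \<subseteq> F \<Longrightarrow> walk G F x ds y"
  by (induction ds arbitrary: x) auto

lemma walk_edges: "walk G E x ds y \<Longrightarrow> fst ` set ds \<subseteq> E"
  by (induction ds arbitrary: x) auto

lemma walk_telescope:
  fixes F :: "'v \<Rightarrow> real"
  shows "walk G E x ds y \<Longrightarrow> (\<Sum>d\<leftarrow>ds. F (end_vertex G d) - F (start_vertex G d)) = F y - F x"
  by (induction ds arbitrary: x) auto

lemma walk_start_nth:
  assumes "walk G E x ds y" "ds \<noteq> []"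
  shows "start_vertex G (ds ! 0) = x"
  using assms by (cases ds) auto

lemma walk_end_nth:
  assumes "walk G E x ds y" "i < length ds"
  shows "end_vertex G (ds ! i) = (if Suc i < length ds then start_vertex G (ds ! Suc i) else y)"
  using assms
proof (induction ds arbitrary: x i)
  case (Cons d ds)
  then show ?case
    by (cases i; cases ds) auto
qed simp

lemma walk_vertices:
  assumes "walk G E x ds y" "d \<in> set ds"
  shows "start_vertex G d \<in> set (map (start_vertex G) ds @ [y])"
    and "end_vertex G d \<in> set (map (start_vertex G) ds @ [y])"
proof -
  show "start_vertex G d \<in> set (map (start_vertex G) ds @ [y])"
    using assms by auto
  from assms(2) obtain i where i: "i < length ds" "d = ds ! i"
    by (metis in_set_conv_nth)
  show "end_vertex G d \<in> set (map (start_vertex G) ds @ [y])"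
    using walk_end_nth[OF assms(1) i(1)] i by (cases "Suc i < length ds") auto
qed

text \<open>Loop erasure: if the new first vertex occurs again later, everything before that
  occurrence is dropped.\<close>

lemma simple_walk_exists:
  "walk G E x ds y \<Longrightarrow> \<exists>ds'. walk G E x ds' y \<and> distinct (map (start_vertex G) ds' @ [y])"
proof (induction ds arbitrary: x)
  case Nil
  then show ?case
    by (intro exI[of _ "[]"]) simp
next
  case (Cons d ds)
  then have d: "fst d \<in> E" "start_vertex G d = x" and "walk G E (end_vertex G d) ds y"
    by auto
  with Cons.IH obtain ds' where ds': "walk G E (end_vertex G d) ds' y"
      "distinct (map (start_vertex G) ds' @ [y])"
    by blast
  consider "x \<notin> set (map (start_vertex G) ds' @ [y])" | "x = y" | "x \<in> start_vertex G ` set ds'"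
    by auto
  then show ?case
  proof cases
    case 1
    then show ?thesis
      using d ds' by (intro exI[of _ "d # ds'"]) auto
  next
    case 2
    then show ?thesis
      by (intro exI[of _ "[]"]) simp
  next
    case 3
    then obtain d' as bs where ds'_eq: "ds' = as @ d' # bs" and d': "start_vertex G d' = x"
      by (metis imageE split_list)
    have "walk G E x (d' # bs) y"
      using ds'(1) d' unfolding ds'_eq walk_append by auto
    moreover have "distinct (map (start_vertex G) (d' # bs) @ [y])"
      using ds'(2) unfolding ds'_eq by auto
    ultimately show ?thesis
      by blast
  qed
qed

lemma start_vertex_cases:
  assumes "fst d = fst d'"
  shows "start_vertex G d = start_vertex G d' \<or> start_vertex G d = end_vertex G d'"
  using assms by (cases d; cases d') auto

text \<open>If the first edge were used again, its start would be an end of that later edge, hence a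
  vertex visited twice.\<close>

lemma simple_walk_distinct_edges:
  assumes "walk G E x ds y" "distinct (map (start_vertex G) ds @ [y])"
  shows "distinct (map fst ds)"
  using assms
proof (induction ds arbitrary: x)
  case (Cons d ds)
  have w: "walk G E (end_vertex G d) ds y"
    using Cons.prems by simp
  have "fst d \<noteq> fst d'" if d': "d' \<in> set ds" for d'
  proof
    assume "fst d = fst d'"
    then have "start_vertex G d \<in> set (map (start_vertex G) ds @ [y])"
      using start_vertex_cases[of d d' G] walk_vertices[OF w d'] by metis
    then show False
      using Cons.prems(2) by simp
  qed
  then show ?case
    using Cons.IH[OF w] Cons.prems(2) by fastforce
qed simp

lemma trail_exists:
  assumes "walk G E x ds y"
  shows "\<exists>ds. walk G E x ds y \<and> distinct (map fst ds)"
proof -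
  obtain ds' where "walk G E x ds' y" "distinct (map (start_vertex G) ds' @ [y])"
    using simple_walk_exists[OF assms] by blast
  then show ?thesis
    using simple_walk_distinct_edges by (intro exI[of _ ds'] conjI)
qed

text \<open>A way back avoiding the edge of d can be made simple, and d closes it to a cycle. If d
  is a loop, the simple way back is empty and d alone is the cycle.\<close>

lemma acyclic_graph_no_return:
  assumes acyc: "acyclic_graph G" and d: "fst d \<in> edges G"
  shows "\<not> walk G (edges G - {fst d}) (end_vertex G d) ds (start_vertex G d)"
proof
  assume "walk G (edges G - {fst d}) (end_vertex G d) ds (start_vertex G d)"
  from simple_walk_exists[OF this]
  obtain ds' where w: "walk G (edges G - {fst d}) (end_vertex G d) ds' (start_vertex G d)"
      and dist: "distinct (map (start_vertex G) ds' @ [start_vertex G d])"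
    by blast
  define c where "c = d # ds'"
  have wc: "walk G (edges G) (start_vertex G d) c (start_vertex G d)"
    unfolding c_def using d walk_mono[OF w Diff_subset] by simp
  have ne: "c \<noteq> []"
    by (simp add: c_def)
  have "end_vertex G (c ! i) = start_vertex G (c ! (Suc i mod length c))" if i: "i < length c" for i
  proof (cases "Suc i < length c")
    case True
    then show ?thesis
      using walk_end_nth[OF wc i] by simp
  next
    case False
    \<comment> \<open>At the last index the successor wraps around to 0, and the closed walk ends at
      its start.\<close>
    then have "Suc i = length c"
      using i by simp
    then show ?thesis
      using walk_end_nth[OF wc i] walk_start_nth[OF wc ne] by simp
  qed
  moreover have "distinct (map fst c)"
    using simple_walk_distinct_edges[OF w dist] walk_edges[OF w] by (auto simp: c_def)
  moreover have "distinct (map (start_vertex G) c)"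
    using dist by (auto simp: c_def)
  ultimately have "is_cycle G c"
    unfolding is_cycle_def using ne walk_edges[OF wc] by (intro conjI allI impI)
  then show False
    using acyc unfolding acyclic_graph_def by blast
qed

section \<open>Positions along a trail\<close>

text \<open>
  In a tree, removing the edge of \<open>d\<close> separates its two ends. Adding up the lengths of the edges
  of a trail that separate \<open>x\<close> from its start gives the position of the projection of \<open>x\<close> to the
  trail.
\<close>

definition beyond :: "('v, 'e) metric_graph \<Rightarrow> 'e \<times> bool \<Rightarrow> 'v \<Rightarrow> bool" where
  "beyond G d x \<longleftrightarrow> (\<exists>ds. walk G (edges G - {fst d}) (end_vertex G d) ds x)"

definition position :: "('v, 'e) metric_graph \<Rightarrow> ('e \<times> bool) list \<Rightarrow> 'v \<Rightarrow> real" where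
  "position G ds x = (\<Sum>d\<leftarrow>ds. len G (fst d) * of_bool (beyond G d x))"

lemma beyond_end: "beyond G d (end_vertex G d)"
  unfolding beyond_def by (rule exI[of _ "[]"]) simp

lemma not_beyond_start: "acyclic_graph G \<Longrightarrow> fst d \<in> edges G \<Longrightarrow> \<not> beyond G d (start_vertex G d)"
  unfolding beyond_def using acyclic_graph_no_return by blast

text \<open>A walk avoiding the edge of d can be prolonged by any other edge, in either
  direction.\<close>

lemma beyond_other_edge:
  assumes "fst d' \<in> edges G" "fst d' \<noteq> fst d"
  shows "beyond G d (start_vertex G d') \<longleftrightarrow> beyond G d (end_vertex G d')"
proof -
  have step: "beyond G d (end_vertex G c)" if "beyond G d (start_vertex G c)" "fst c = fst d'" for c
  proof -
    from that obtain ds where "walk G (edges G - {fst d}) (end_vertex G d) ds (start_vertex G c)"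
      unfolding beyond_def by blast
    then have "walk G (edges G - {fst d}) (end_vertex G d) (ds @ [c]) (end_vertex G c)"
      using assms that by (auto simp: walk_append)
    then show ?thesis
      unfolding beyond_def by blast
  qed
  obtain e b where "d' = (e, b)"
    by (cases d')
  then show ?thesis
    using step[of "(e, b)"] step[of "(e, \<not> b)"] by (cases b) auto
qed

text \<open>Crossing d switches the indicator of d itself from 0 to 1. The other edges of the trail
  differ from that of d, so their indicators do not change.\<close>

lemma position_start_end:
  assumes acyc: "acyclic_graph G" and ds: "fst ` set ds \<subseteq> edges G" "distinct (map fst ds)"
    and d: "d \<in> set ds"
  shows "position G ds (end_vertex G d) = position G ds (start_vertex G d) + len G (fst d)"
proof -
  have de: "fst d \<in> edges G"
    using ds d by auto
  have eq: "position G ds x = (\<Sum>d\<in>set ds. len G (fst d) * of_bool (beyond G d x))" for x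
    unfolding position_def using ds(2) by (simp add: sum_list_distinct_conv_sum_set distinct_map)
  have "position G ds (end_vertex G d) - position G ds (start_vertex G d) =
      (\<Sum>d'\<in>set ds. len G (fst d') * of_bool (beyond G d' (end_vertex G d))
        - len G (fst d') * of_bool (beyond G d' (start_vertex G d)))"
    unfolding eq by (rule sum_subtractf[symmetric])
  also have "\<dots> = (\<Sum>d'\<in>set ds. if d' = d then len G (fst d) else 0)"
  proof (rule sum.cong[OF HOL.refl])
    fix d' assume d': "d' \<in> set ds"
    show "len G (fst d') * of_bool (beyond G d' (end_vertex G d))
        - len G (fst d') * of_bool (beyond G d' (start_vertex G d)) = (if d' = d then len G (fst d) else 0)"
    proof (cases "d' = d")
      case True
      then show ?thesis
        using beyond_end[of G d] not_beyond_start[OF acyc de] by simp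
    next
      case False
      then have "fst d \<noteq> fst d'"
        using ds(2) d d' by (auto simp: distinct_map inj_on_def)
      then show ?thesis
        using beyond_other_edge[OF de] False by simp
    qed
  qed
  also have "\<dots> = len G (fst d)"
    using d by simp
  finally show ?thesis
    by simp
qed

lemma position_other_edge:
  assumes e: "e \<in> edges G" "e \<notin> fst ` set ds"
  shows "position G ds (tail G e) = position G ds (head G e)"
proof -
  have "beyond G d (tail G e) \<longleftrightarrow> beyond G d (head G e)" if "d \<in> set ds" for d
    using beyond_other_edge[of "(e, True)" G d] e that by force
  then show ?thesis
    unfolding position_def by (intro arg_cong[where f=sum_list] map_cong) auto
qed

context compact_connected_metric_graph
begin

lemma position_bounds:
  assumes "fst ` set ds \<subseteq> edges G"
  shows "0 \<le> position G ds x" "position G ds x \<le> walk_length G ds"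
proof -
  have "0 \<le> len G (fst d)" if "d \<in> set ds" for d
    using assms that by (auto intro: less_imp_le[OF len_pos])
  then show "0 \<le> position G ds x" "position G ds x \<le> walk_length G ds"
    unfolding position_def walk_length_def
    by (auto intro!: sum_list_nonneg sum_list_mono)
qed

text \<open>The increments of the position along the trail telescope to the full length. As
  positions lie between 0 and this length, both extremes must be attained, at the start and at the
  end.\<close>

lemma position_ends:
  assumes "acyclic_graph G" and w: "walk G (edges G) x ds y" and dist: "distinct (map fst ds)"
  shows "position G ds x = 0" "position G ds y = walk_length G ds"
proof -
  note e = walk_edges[OF w]
  have "walk_length G ds = (\<Sum>d\<leftarrow>ds. position G ds (end_vertex G d) - position G ds (start_vertex G d))"
    unfolding walk_length_def
    using position_start_end[OF assms(1) e dist] by (intro arg_cong[where f=sum_list] map_cong) auto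
  also have "\<dots> = position G ds y - position G ds x"
    by (rule walk_telescope[OF w])
  finally show "position G ds x = 0" "position G ds y = walk_length G ds"
    using position_bounds[OF e, of x] position_bounds[OF e, of y] by auto
qed

text \<open>
  The test function is \<open>h(p) = \<kappa> p - p\<^sup>2 / 2\<close> at position \<open>p\<close>; the right-hand side is the integral
  of \<open>2 h - h'\<^sup>2\<close> over the trail.
\<close>

lemma torsional_rigidity_ge_trail:
  assumes acyc: "acyclic_graph G" and D: "D \<subseteq> verts G" "D \<noteq> {}"
    and w: "walk G (edges G) x ds y" and dist: "distinct (map fst ds)"
    and \<kappa>: "walk_length G ds \<le> 2 * \<kappa>"
    and zero: "\<And>v. v \<in> D \<Longrightarrow> \<kappa> * position G ds v = (position G ds v)\<^sup>2 / 2"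
  shows "2 * \<kappa> * (walk_length G ds)\<^sup>2 - 2 * walk_length G ds ^ 3 / 3 - \<kappa>\<^sup>2 * walk_length G ds
    \<le> torsional_rigidity G D"
proof -
  note ed = walk_edges[OF w]
  define p where "p = position G ds"
  define g where "g v = \<kappa> * p v - (p v)\<^sup>2 / 2" for v
  \<comment> \<open>\<open>H\<close> is the antiderivative of 2 h - h'^2 = 2 (\<kappa> t - t^2 / 2)
    - (\<kappa> - t)^2 that vanishes at 0.\<close>
  define H where "H t = 2 * \<kappa> * t\<^sup>2 - 2 * t ^ 3 / 3 - \<kappa>\<^sup>2 * t" for t
  define F where "F e = len G e * (g (tail G e) + g (head G e))
    - (g (head G e) - g (tail G e))\<^sup>2 / len G e + len G e ^ 3 / 12" for e
  \<comment> \<open>Positions are at most the trail length, hence at most 2 \<kappa>, the second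
    zero of h.\<close>
  have g_nonneg: "0 \<le> g v" for v
  proof -
    have "0 \<le> p v" "p v \<le> 2 * \<kappa>"
      using position_bounds[OF ed, of v] \<kappa> by (auto simp: p_def)
    then have "0 \<le> p v * (2 * \<kappa> - p v)"
      by simp
    then show ?thesis
      by (simp add: g_def power2_eq_square algebra_simps)
  qed
  have F_other: "0 \<le> F e" if "e \<in> edges G - fst ` set ds" for e
  proof -
    \<comment> \<open>Off the trail the position is constant along e, so the squared difference
      drops out of \<open>F e\<close>.\<close>
    have "g (tail G e) = g (head G e)"
      using position_other_edge[of e G ds] that by (simp add: g_def p_def)
    then show ?thesis
      using that g_nonneg[of "head G e"] len_pos[of e] by (simp add: F_def)
  qed
  have F_trail: "F (fst d) = H (p (end_vertex G d)) - H (p (start_vertex G d))" if d: "d \<in> set ds" for d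
  proof -
    define l where "l = len G (fst d)"
    have l: "0 < l"
      using d ed len_pos by (auto simp: l_def)
    define a where "a = p (start_vertex G d)"
    have pe: "p (end_vertex G d) = a + l"
      using position_start_end[OF acyc ed dist d] by (simp add: p_def a_def l_def)
    have gs: "g (start_vertex G d) = \<kappa> * a - a\<^sup>2 / 2" and ge: "g (end_vertex G d) = \<kappa> * (a + l) - (a + l)\<^sup>2 / 2"
      unfolding g_def pe by (simp_all add: a_def)
    \<comment> \<open>\<open>F\<close> is symmetric in tail and head, so the direction in which the
      trail runs through the edge does not matter.\<close>
    have "F (fst d) = l * (g (start_vertex G d) + g (end_vertex G d))
        - (g (end_vertex G d) - g (start_vertex G d))\<^sup>2 / l + l ^ 3 / 12"
      by (cases d; cases "snd d") (auto simp: F_def l_def power2_commute add.commute)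
    also have "g (end_vertex G d) - g (start_vertex G d) = l * (\<kappa> - a - l / 2)"
      unfolding gs ge by (simp add: power2_eq_square field_simps)
    also have "(l * (\<kappa> - a - l / 2))\<^sup>2 / l = l * (\<kappa> - a - l / 2)\<^sup>2"
      using l by (simp add: power2_eq_square)
    also have "l * (g (start_vertex G d) + g (end_vertex G d)) - l * (\<kappa> - a - l / 2)\<^sup>2 + l ^ 3 / 12
        = H (a + l) - H a"
      unfolding gs ge H_def by (simp add: power2_eq_square power3_eq_cube field_simps)
    finally show ?thesis
      unfolding pe a_def .
  qed
  have "H (walk_length G ds) = H (p y) - H (p x)"
    using position_ends[OF acyc w dist] by (simp add: p_def H_def)
  also have "\<dots> = (\<Sum>d\<leftarrow>ds. H (p (end_vertex G d)) - H (p (start_vertex G d)))"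
    by (rule walk_telescope[OF w, of "\<lambda>v. H (p v)", symmetric])
  also have "\<dots> = (\<Sum>e\<leftarrow>map fst ds. F e)"
    unfolding map_map comp_def by (intro arg_cong[where f=sum_list] map_cong HOL.refl) (simp add: F_trail)
  also have "\<dots> = (\<Sum>e\<in>fst ` set ds. F e)"
    using sum_list_distinct_conv_sum_set[OF dist, of F] by simp
  also have "\<dots> \<le> (\<Sum>e\<in>edges G. F e)"
    using F_other by (intro sum_mono2 finite_edges ed)
  also have "\<dots> \<le> torsional_rigidity G D"
    unfolding F_def using zero by (intro torsional_rigidity_ge[OF D]) (simp add: g_def p_def)
  finally show ?thesis
    by (simp add: H_def)
qed

section \<open>Reaching vertices and points by trails\<close>

lemma trail_between:
  assumes "x \<in> verts G" "y \<in> verts G"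
  obtains ds where "walk G (edges G) x ds y" "distinct (map fst ds)"
proof -
  have "\<exists>ds. walk G (edges G) x ds y"
    using connected_verts[OF assms]
  proof (induction rule: rtrancl_induct)
    case base
    then show ?case
      by (intro exI[of _ "[]"]) simp
  next
    case (step y z)
    from step(2) obtain e where e: "e \<in> edges G"
      "y = tail G e \<and> z = head G e \<or> y = head G e \<and> z = tail G e"
      unfolding adjacency_def by blast
    define d where "d = (e, y = tail G e \<and> z = head G e)"
    have d: "fst d \<in> edges G" "start_vertex G d = y" "end_vertex G d = z"
      using e by (auto simp: d_def)
    from step(3) obtain ds where "walk G (edges G) x ds y"
      by blast
    then have "walk G (edges G) x (ds @ [d]) z"
      using d by (auto simp: walk_append)
    then show ?case by blast
  qed
  then show thesis
    using trail_exists that by metis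
qed

lemma joined_edge_direction:
  assumes "fst d \<in> edges G" "t \<in> {0..len G (fst d)}"
  shows "\<exists>K\<le>len G (fst d). joined G (Vertex (start_vertex G d)) (edge_point G (fst d) t) K"
proof -
  obtain e b where d: "d = (e, b)"
    by (cases d)
  have "joined G (Vertex (start_vertex G d)) (edge_point G e t) (if b then t else len G e - t)"
    using joined_edge[of e G 0 t] joined_edge[of e G "len G e" t] assms
    by (cases b) (auto simp: d edge_point_0 edge_point_len)
  then show ?thesis
    using assms(2) by (intro exI[of _ "if b then t else len G e - t"]) (auto simp: d)
qed

lemma joined_walk:
  assumes "walk G (edges G) x ds y" "x \<in> verts G"
  shows "joined G (Vertex x) (Vertex y) (walk_length G ds)"
  using assms
proof (induction ds arbitrary: x)
  case Nil
  then show ?case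
    using joined.refl[of "Vertex x" G] by (simp add: walk_length_def points_def)
next
  case (Cons d ds)
  then have e: "fst d \<in> edges G" "start_vertex G d = x" and w: "walk G (edges G) (end_vertex G d) ds y"
    by auto
  obtain e b where d: "d = (e, b)"
    by (cases d)
  have "joined G (Vertex x) (Vertex (end_vertex G d)) (len G (fst d))"
    using e joined_edge_ends[of e] joined_sym[OF joined_edge_ends[of e]] by (cases b) (auto simp: d)
  moreover have "end_vertex G d \<in> verts G"
    using e head_in_verts tail_in_verts by (cases b) (auto simp: d)
  ultimately show ?case
    using joined_trans[OF Cons.IH[OF w]] by (simp add: walk_length_def)
qed

lemma walk_length_nonneg: "fst ` set ds \<subseteq> edges G \<Longrightarrow> 0 \<le> walk_length G ds"
  unfolding walk_length_def by (rule sum_list_nonneg) (auto dest!: subsetD intro!: less_imp_le[OF len_pos])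

text \<open>For a point inside an edge e, the trail is made to traverse e completely. Its part
  before e, followed by a piece of e, reaches the point and is no longer than the whole
  trail.\<close>

lemma path_dist_le_trail:
  assumes v: "v \<in> verts G" and p: "p \<in> points G"
  obtains ds y where "walk G (edges G) v ds y" "distinct (map fst ds)"
    "path_dist G p (Vertex v) \<le> walk_length G ds"
  using p
proof (cases rule: points_cases)
  case (1 x)
  obtain ds where ds: "walk G (edges G) v ds x" "distinct (map fst ds)"
    using trail_between[OF v 1(1)] .
  then show ?thesis
    using that path_dist_le[OF joined_sym[OF joined_walk[OF ds(1) v]]] 1(2) by blast
next
  case (2 e t)
  obtain ds where ds: "walk G (edges G) v ds (tail G e)" "distinct (map fst ds)"
    using trail_between[OF v tail_in_verts[OF 2(1)]] .
  \<comment> \<open>Either the trail to the tail of e already uses e, or e can be appended without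
    repeating an edge.\<close>
  have "\<exists>ds y. walk G (edges G) v ds y \<and> distinct (map fst ds) \<and> e \<in> fst ` set ds"
  proof (cases "e \<in> fst ` set ds")
    case False
    then have "walk G (edges G) v (ds @ [(e, True)]) (head G e)" "distinct (map fst (ds @ [(e, True)]))"
      using ds 2(1) by (auto simp: walk_append)
    then show ?thesis
      by (intro exI[of _ "ds @ [(e, True)]"] exI[of _ "head G e"]) simp
  qed (use ds in blast)
  then obtain ds y where w: "walk G (edges G) v ds y" and dist: "distinct (map fst ds)" and "e \<in> fst ` set ds"
    by blast
  then obtain as d bs where eq: "ds = as @ d # bs" and d: "fst d = e"
    by (metis imageE split_list)
  have as: "walk G (edges G) v as (start_vertex G d)"
    using w by (auto simp: eq walk_append)
  obtain K where K: "K \<le> len G e" "joined G (Vertex (start_vertex G d)) p K"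
    using joined_edge_direction[of d t] 2 by (auto simp: d edge_point_Interior)
  have "path_dist G p (Vertex v) \<le> walk_length G as + K"
    by (rule path_dist_le[OF joined_sym[OF joined_trans[OF K(2) joined_walk[OF as v]]]])
  also have "\<dots> \<le> walk_length G ds"
  proof -
    have "fst ` set bs \<subseteq> edges G"
      using walk_edges[OF w] by (auto simp: eq)
    then show ?thesis
      using K(1) walk_length_nonneg[of bs] by (simp add: eq walk_length_def d)
  qed
  finally show ?thesis
    using that w dist by blast
qed

end

section \<open>Lower bounds for one and for two Dirichlet vertices\<close>

theorem proposition4p5:
  fixes G :: "('v, 'e) metric_graph" and D :: "'v set"
  assumes "compact_connected_metric_graph G"
    and "acyclic_graph G"
    and "D \<subseteq> verts G" and "D \<noteq> {}"
  shows "(card D = 1 \<longrightarrow> torsional_rigidity G D \<ge> 1 / 3 * inradius G D ^ 3) \<and>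
    (\<forall>v w. v \<noteq> w \<and> D = {v, w} \<longrightarrow>
       torsional_rigidity G D \<ge> 1 / 12 * path_dist G (Vertex v) (Vertex w) ^ 3)"
proof (intro conjI impI allI)
  interpret compact_connected_metric_graph G by fact
  show "torsional_rigidity G D \<ge> 1 / 3 * inradius G D ^ 3" if "card D = 1"
  proof -
    obtain v where D: "D = {v}"
      using \<open>card D = 1\<close> by (auto simp: card_1_singleton_iff)
    then have v: "v \<in> verts G"
      using assms(3) by simp
    \<comment> \<open>The cubic inequality for each trail is turned into one bound \<open>R\<close>
      on all distances, which then bounds their supremum.\<close>
    define R where "R = root 3 (3 * torsional_rigidity G D)"
    have "path_dist G p (Vertex v) \<le> R" if p: "p \<in> points G" for p
    proof -
      obtain ds y where w: "walk G (edges G) v ds y" and dist: "distinct (map fst ds)"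
          and le: "path_dist G p (Vertex v) \<le> walk_length G ds"
        using path_dist_le_trail[OF v p] .
      define L where "L = walk_length G ds"
      \<comment> \<open>With \<kappa> = L the profile h has slope 0 at the free end of the trail;
        the left side equals L^3 / 3.\<close>
      have "2 * L * L\<^sup>2 - 2 * L ^ 3 / 3 - L\<^sup>2 * L \<le> torsional_rigidity G D"
        unfolding L_def
        using walk_length_nonneg[OF walk_edges[OF w]] position_ends(1)[OF assms(2) w dist]
        by (intro torsional_rigidity_ge_trail[OF assms(2-4) w dist]) (auto simp: D)
      then have "L ^ 3 \<le> 3 * torsional_rigidity G D"
        by (simp add: power2_eq_square power3_eq_cube)
      then have "root 3 (L ^ 3) \<le> R"
        unfolding R_def by (intro real_root_le_mono) auto
      then show ?thesis
        using le by (simp add: L_def odd_real_root_power_cancel)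
    qed
    moreover have "points G \<noteq> {}"
      using v by (auto simp: points_def)
    ultimately have "inradius G D \<le> R"
      unfolding inradius_def by (intro cSUP_least) (auto simp: D)
    then have "inradius G D ^ 3 \<le> R ^ 3"
      by (intro power_mono_odd) auto
    also have "R ^ 3 = 3 * torsional_rigidity G D"
      unfolding R_def by (intro odd_real_root_pow) simp
    finally show ?thesis
      by simp
  qed
  show "torsional_rigidity G D \<ge> 1 / 12 * path_dist G (Vertex v) (Vertex w) ^ 3"
    if vw: "v \<noteq> w \<and> D = {v, w}" for v w
  proof -
    have v: "v \<in> verts G" and w: "w \<in> verts G"
      using vw assms(3) by auto
    obtain ds where ds: "walk G (edges G) v ds w" and dist: "distinct (map fst ds)"
      using trail_between[OF v w] .
    define L where "L = walk_length G ds"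
    have "path_dist G (Vertex v) (Vertex w) ^ 3 \<le> L ^ 3"
      unfolding L_def using path_dist_le[OF joined_walk[OF ds v]] by (intro power_mono_odd) auto
    \<comment> \<open>With \<kappa> = L / 2 the profile h vanishes at both ends of the trail; the
      left side equals L^3 / 12.\<close>
    moreover have "2 * (L / 2) * L\<^sup>2 - 2 * L ^ 3 / 3 - (L / 2)\<^sup>2 * L \<le> torsional_rigidity G D"
      unfolding L_def using position_ends[OF assms(2) ds dist] vw
      by (intro torsional_rigidity_ge_trail[OF assms(2-4) ds dist]) (auto simp: power2_eq_square)
    ultimately show ?thesis
      by (simp add: power2_eq_square power3_eq_cube)
  qed
qed


end
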